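(* Let $\Omega$, $S$, $\gamma_0$, $X$, $\gamma_t$, $\mathcal{O}$, $\Phi$ and $f$ be as described in the context. Then for any $\varepsilon>0$ there exists a function $R\in C^\infty([0,1],C^\omega(\mathbb{C}\setminus S))$ such that for any $t\in[0,1]$ the function $z\mapsto R(t,z)$ is a rational function whose poles are exactly the points of $S$, and such that $$\sup_{t\in[0,1]}\|f(t,\cdot)-R(t,\cdot)\|_{L^\infty(\mathrm{insd}(\gamma_t))}\le\varepsilon .$$
   Context: Identify $\mathbb{R}^2$ with $\mathbb{C}$. Let $\Omega\subset\mathbb{C}$ be a smooth bounded domain (connected open set), and let $S\subset\mathbb{C}$ be a set having exactly one point in each connected component of $\mathbb{C}\setminus\Omega$ and no other points. $C^\omega$ denotes real-analytic functions. For a Jordan curve $\gamma$, $\mathrm{insd}(\gamma)$ denotes the bounded connected component of $\mathbb{C}\setminus\gamma$. For a vector field $X:[0,1]\times\Omega\to\mathbb{R}^2$, the flow $\Phi^X$ is defined by $\partial_t\Phi^X(s,t,x)=X(t,\Phi^X(s,t,x))$, $\Phi^X(s,s,x)=x$, and $\Phi^X(0,t,\gamma):=\Phi^X(0,t,\cdot)(\gamma)$. Let $\gamma_0$ and $\gamma_1$ be smooth Jordan curves homotopic in $\Omega$, with $\gamma_0$ real-analytic (parametrized by an element of $C^\omega(\mathbb{S}^1,\mathbb{C})$). Let $X$ be a smooth vector field with $X(0,\cdot)\equiv X(1,\cdot)\equiv0$, $X(t,\cdot)=0$ on $\partial\Omega$, $\mathrm{div}\,X(t,\cdot)=0$ in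 $\Omega$, $\gamma_t:=\Phi^X(0,t,\gamma_0)\subset\Omega$ for all $t\in[0,1]$, and $\Phi^X(0,1,\gamma_0)=\gamma_1$. Let $\mathcal{O}\subset\Omega$ be an open set such that $\overline{\mathcal{O}}\subset\Omega$, such that for some integer $p\ge0$ the set $\mathbb{C}\setminus\mathcal{O}$ has exactly $p+1$ connected components, each of them containing exactly one element of $S$, and such that $\gamma_t\subset\mathcal{O}$ for all $t\in[0,1]$. Assume moreover that $X\in C_0^\infty([0,1],C_0^\infty(\Omega)\cap C^\omega(\mathcal{O}))$ and that there exists $\Phi\in C_0^\infty([0,1],C^\omega(\mathcal{O}))$ such that $\nabla\Phi(t,\cdot)=X(t,\cdot)$ in $\mathcal{O}$ for all $t\in[0,1]$. A Jordan curve $\widetilde\gamma_0$ is considered with $\gamma_0\subset\mathrm{insd}(\widetilde\gamma_0)\subset\mathcal{O}$. For a complex function $f=f_1+\mathrm{i}f_2$ ($f_1,f_2$ real valued) set $V_f:=(f_1,-f_2)^{T}$. The function $f$ is defined by $V_{f(t,\cdot)}=\nabla\Phi(t,\cdot)$ for $t\in[0,1]$; since $X(t,\cdot)$ is divergence free, $f(t,\cdot)$ is holomorphic on $\mathcal{O}$. *)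

theory Defs
  imports "HOL-Complex_Analysis.Complex_Analysis" "HOL-Probability.Essential_Supremum"
begin

section \<open>Smooth and real-analytic functions\<close>

text \<open>
  \<open>smooth_on A f\<close>: \<open>f\<close> is \<open>C\<^sup>\<infinity>\<close> on \<open>A\<close>, i.e. \<open>f\<close> is Frechet differentiable on \<open>A\<close> and so,
  hereditarily, are all its directional derivatives. It is used for open \<open>A\<close> and for
  \<open>A = [0,1] \<times> U\<close> with \<open>U\<close> open; in both cases the derivative within \<open>A\<close> is unique, and in the
  second case this is smoothness up to the end points of the time interval.
\<close>

coinductive smooth_on ::
  "'a::euclidean_space set \<Rightarrow> ('a \<Rightarrow> 'b::real_normed_vector) \<Rightarrow> bool" for A where
  "\<lbrakk>\<And>x. x \<in> A \<Longrightarrow> (f has_derivative f' x) (at x within A); \<And>v. smooth_on A (\<lambda>x. f' x v)\<rbrakk>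
    \<Longrightarrow> smooth_on A f"

definition multi_indices :: "('a::euclidean_space \<Rightarrow> nat) set" where
  "multi_indices = {\<alpha>. \<forall>b. b \<notin> Basis \<longrightarrow> \<alpha> b = 0}"

text \<open>
  Every point of \<open>U\<close> has a neighbourhood on which all \<open>u t\<close>, \<open>t \<in> T\<close>, are sums of their power
  series, with one radius \<open>r\<close> and one Cauchy bound \<open>M / r\<^sup>|\<^sup>\<alpha>\<^sup>|\<close> for the coefficients, valid for
  all \<open>t \<in> T\<close>.
\<close>

definition uniformly_analytic_on ::
  "'t set \<Rightarrow> 'a::euclidean_space set \<Rightarrow> ('t \<Rightarrow> 'a \<Rightarrow> 'b::real_normed_vector) \<Rightarrow> bool" where
  "uniformly_analytic_on T U u \<longleftrightarrow>
     (\<forall>x\<in>U. \<exists>r>0. \<exists>M. \<exists>c. \<forall>t\<in>T.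
        (\<forall>\<alpha>\<in>multi_indices. norm (c t \<alpha>) * r ^ (\<Sum>b\<in>Basis. \<alpha> b) \<le> M) \<and>
        (\<forall>y\<in>ball x r.
           ((\<lambda>\<alpha>. (\<Prod>b\<in>Basis. ((y - x) \<bullet> b) ^ \<alpha> b) *\<^sub>R c t \<alpha>) has_sum u t y) multi_indices))"

definition real_analytic_on ::
  "'a::euclidean_space set \<Rightarrow> ('a \<Rightarrow> 'b::real_normed_vector) \<Rightarrow> bool" where
  "real_analytic_on U f \<longleftrightarrow> uniformly_analytic_on {()} U (\<lambda>_. f)"


section \<open>Function spaces over the time interval\<close>

definition time_deriv ::
  "(real \<Rightarrow> 'a \<Rightarrow> 'b::real_normed_vector) \<Rightarrow> real \<Rightarrow> 'a \<Rightarrow> 'b" where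
  "time_deriv u t x = vector_derivative (\<lambda>s. u s x) (at t within {0..1})"

text \<open>
  \<open>C\<^sup>\<infinity>([0,1], C\<^sup>\<omega>(U))\<close> for open \<open>U\<close>: \<open>u\<close> is jointly smooth and all its time derivatives are
  real-analytic in space, locally uniformly in the sense above. The uniformity expresses that
  \<open>C\<^sup>\<omega>(U)\<close> carries its usual topology (and not that of \<open>C\<^sup>\<infinity>(U)\<close>).
\<close>

definition smooth_time_analytic_on ::
  "'a::euclidean_space set \<Rightarrow> (real \<Rightarrow> 'a \<Rightarrow> 'b::real_normed_vector) \<Rightarrow> bool" where
  "smooth_time_analytic_on U u \<longleftrightarrow>
     smooth_on ({0..1} \<times> U) (\<lambda>(t, x). u t x) \<and>
     (\<forall>k. uniformly_analytic_on {0..1} U ((time_deriv ^^ k) u))"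

text \<open>
  \<open>C\<^sub>0\<^sup>\<infinity>([0,1], C\<^sup>\<omega>(U))\<close>; on the time interval, the subscript 0 means compact support
  in the open interval \<open>(0,1)\<close>.
\<close>

definition smooth_time_analytic_cpt_on ::
  "'a::euclidean_space set \<Rightarrow> (real \<Rightarrow> 'a \<Rightarrow> 'b::real_normed_vector) \<Rightarrow> bool" where
  "smooth_time_analytic_cpt_on U u \<longleftrightarrow>
     smooth_time_analytic_on U u \<and>
     (\<exists>J. compact J \<and> J \<subseteq> {0<..<1} \<and> (\<forall>t\<in>{0..1} - J. \<forall>x\<in>U. u t x = 0))"

text \<open>
  \<open>C\<^sub>0\<^sup>\<infinity>([0,1], C\<^sub>0\<^sup>\<infinity>(\<Omega>))\<close>, where \<open>C\<^sub>0\<^sup>\<infinity>(\<Omega>)\<close> are the smooth functions with compact support in the open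
  set \<open>\<Omega>\<close>. With its usual (inductive limit) topology the functions \<open>u t\<close> are supported in a common
  compact set, so that this is the space of smooth functions with compact support in
  \<open>(0,1) \<times> \<Omega>\<close>.
\<close>

definition smooth_time_cpt_on ::
  "'a::euclidean_space set \<Rightarrow> (real \<Rightarrow> 'a \<Rightarrow> 'b::real_normed_vector) \<Rightarrow> bool" where
  "smooth_time_cpt_on \<Omega> u \<longleftrightarrow>
     smooth_on ({0..1} \<times> \<Omega>) (\<lambda>(t, x). u t x) \<and>
     (\<exists>K. compact K \<and> K \<subseteq> {0<..<1} \<times> \<Omega> \<and> (\<forall>t\<in>{0..1}. \<forall>x\<in>\<Omega>. (t, x) \<notin> K \<longrightarrow> u t x = 0))"


section \<open>Planar domains, Jordan curves and vector fields\<close>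

text \<open>
  Near each boundary point \<open>a\<close>, in coordinates centred at \<open>a\<close> and rotated by the unit number \<open>w\<close>,
  the domain is the part of a ball above the graph of a smooth function.
\<close>

definition smooth_bounded_domain :: "complex set \<Rightarrow> bool" where
  "smooth_bounded_domain \<Omega> \<longleftrightarrow>
     open \<Omega> \<and> connected \<Omega> \<and> bounded \<Omega> \<and>
     (\<forall>a\<in>frontier \<Omega>. \<exists>r>0. \<exists>w. \<exists>g :: real \<Rightarrow> real.
        norm w = 1 \<and> smooth_on UNIV g \<and>
        (\<forall>z\<in>ball a r. z \<in> \<Omega> \<longleftrightarrow> g (Re (w * (z - a))) < Im (w * (z - a))))"

definition jordan_curve :: "(real \<Rightarrow> complex) \<Rightarrow> bool" where
  "jordan_curve \<gamma> \<longleftrightarrow> simple_path \<gamma> \<and> pathfinish \<gamma> = pathstart \<gamma>"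

text \<open>
  Functions on the circle are 1-periodic functions on the line. A smooth Jordan curve is smoothly
  embedded, so its parametrization is required to be regular.
\<close>

definition smooth_jordan_curve :: "(real \<Rightarrow> complex) \<Rightarrow> bool" where
  "smooth_jordan_curve \<gamma> \<longleftrightarrow>
     jordan_curve \<gamma> \<and> (\<forall>x. \<gamma> (x + 1) = \<gamma> x) \<and> smooth_on UNIV \<gamma> \<and>
     (\<forall>x. vector_derivative \<gamma> (at x) \<noteq> 0)"

definition divergence :: "(complex \<Rightarrow> complex) \<Rightarrow> complex \<Rightarrow> real" where
  "divergence Y z =
     Re (frechet_derivative Y (at z) 1) + Im (frechet_derivative Y (at z) \<i>)"

text \<open>\<open>F s t x\<close> is the position at time \<open>t\<close> of the particle which is at \<open>x\<close> at time \<open>s\<close>.\<close>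

definition is_flow ::
  "complex set \<Rightarrow> (real \<Rightarrow> complex \<Rightarrow> complex) \<Rightarrow> (real \<Rightarrow> real \<Rightarrow> complex \<Rightarrow> complex) \<Rightarrow> bool" where
  "is_flow \<Omega> X F \<longleftrightarrow>
     (\<forall>s\<in>{0..1}. \<forall>x\<in>\<Omega>. F s s x = x \<and>
        (\<forall>t\<in>{0..1}. F s t x \<in> \<Omega> \<and>
           ((\<lambda>\<tau>. F s \<tau> x) has_vector_derivative X t (F s t x)) (at t within {0..1})))"

text \<open>The vector field \<open>V\<^sub>f = (f\<^sub>1, - f\<^sub>2)\<close> of \<open>f = f\<^sub>1 + \<i> f\<^sub>2\<close>.\<close>

definition vfield :: "(complex \<Rightarrow> complex) \<Rightarrow> complex \<Rightarrow> complex" where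
  "vfield f z = Complex (Re (f z)) (- Im (f z))"


section \<open>Rational functions\<close>

definition rational_on :: "complex set \<Rightarrow> (complex \<Rightarrow> complex) \<Rightarrow> bool" where
  "rational_on A r \<longleftrightarrow> (\<exists>P Q. \<forall>z\<in>A. poly Q z \<noteq> 0 \<and> r z = poly P z / poly Q z)"

text \<open>
  Poles are understood on the Riemann sphere, so the second clause also excludes a pole at infinity.
  The values of \<open>r\<close> on \<open>S\<close> are irrelevant.
\<close>

definition rational_with_poles_exactly :: "complex set \<Rightarrow> (complex \<Rightarrow> complex) \<Rightarrow> bool" where
  "rational_with_poles_exactly S r \<longleftrightarrow>
     rational_on (- S) r \<and> {z. is_pole r z} = S \<and> \<not> filterlim r at_infinity at_infinity"

end

theory Submission
  imports Defs
begin

text \<open>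
  The Cauchy-Riemann equations for \<open>f t = cnj (X t)\<close> are the symmetry of the second derivative of
  \<open>\<Phi> t\<close> together with \<open>div X = 0\<close>, so \<open>f t\<close> is holomorphic on \<open>\<O>\<close>. The flow is a homotopy in \<open>\<O>\<close> from
  \<open>\<gamma>\<^sub>0\<close> to \<open>\<gamma>\<^sub>t\<close>, hence \<open>\<gamma>\<^sub>t\<close> has winding number \<open>0\<close> about the points outside \<open>\<O>\<close>, and the insides of
  all the curves lie in the compact set \<open>K\<close> of the points at distance at least \<open>r\<close> from the
  complement of \<open>\<O>\<close>. As \<open>f\<close> is continuous on \<open>[0,1] \<times> K\<close>, its Bernstein polynomials in time
  approximate it uniformly there, so it suffices to apply Runge's theorem at the finitely many times
  \<open>k / n\<close>; the approximant is a polynomial in \<open>t\<close> with rational functions as coefficients.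
\<close>

section \<open>Bernstein approximation\<close>

text \<open>The supremum runs over all times, so one compact set must serve every \<open>t\<close>.
  Cutting \<open>K\<close> out by distance to \<open>- \<O>\<close> meets two demands at once: a
  disc of radius \<open>r\<close> about a point outside \<open>\<O>\<close> misses all the curves,
  which puts every inside into \<open>K\<close>; and such discs join the points of
  \<open>- K\<close>, within \<open>- K\<close>, to \<open>- \<O>\<close>, whose components all meet
  \<open>S\<close>. Hence every pole can be pushed into \<open>S\<close>, the unbounded component
  included, and the approximants are sums of polynomials in \<open>inverse (z - s)\<close> without a
  pole at infinity. Polynomial dependence on time yields joint smoothness and uniform analyticity,
  because time differentiation acts on the real polynomial factors only. A flow is given here only
  through its trajectories; its joint continuity and injectivity are extracted from a Lipschitz
  bound on \<open>X\<close>, which survives the possible nonconvexity of \<open>\<Omega>\<close>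
  thanks to the compact support.\<close>

lemma Bernstein_variance:
  assumes "n > 0"
  shows "(\<Sum>k\<le>n. Bernstein n k x * (x - real k / real n)\<^sup>2) = x * (1 - x) / real n"
proof -
  \<comment> \<open>This is the variance of the binomial distribution. Writing
    \<open>k\<^sup>2\<close> as \<open>k + k * (k - 1)\<close> reduces it to the known sums of
    \<open>B\<close>, \<open>k * B\<close> and \<open>k * (k - 1) * B\<close>, where
    \<open>B\<close> is the Bernstein weight.\<close>
  have "(real n)\<^sup>2 * (\<Sum>k\<le>n. Bernstein n k x * (x - real k / real n)\<^sup>2) =
      (\<Sum>k\<le>n. (n * x)\<^sup>2 * Bernstein n k x + (1 - 2 * n * x) * (real k * Bernstein n k x)
        + real k * (real k - 1) * Bernstein n k x)"
    unfolding sum_distrib_left using assms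
    by (intro sum.cong) (auto simp: field_simps power2_eq_square)
  also have "\<dots> = (n * x)\<^sup>2 + (1 - 2 * n * x) * (n * x) + n * (real n - 1) * x\<^sup>2"
    by (simp add: sum.distrib flip: sum_distrib_left)
  also have "\<dots> = (real n)\<^sup>2 * (x * (1 - x) / n)"
    using assms by (simp add: field_simps power2_eq_square)
  finally show ?thesis
    by (subst (asm) mult_cancel_left) (use assms in simp)
qed

text \<open>Bernstein's proof of the Weierstrass theorem with a parameter \<open>z\<close>: joint
  uniform continuity makes \<open>n\<close> independent of \<open>z\<close>. It serves twice, for
  the time variable and as a quadrature rule for Cauchy integrals.\<close>

lemma Bernstein_approximation:
  fixes g :: "real \<Rightarrow> 'a::metric_space \<Rightarrow> 'b::real_normed_vector"
  assumes "compact K" and g: "continuous_on ({0..1} \<times> K) (\<lambda>(t, z). g t z)" and "\<epsilon> > 0"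
  obtains n where "n > 0"
    and "\<And>t z. t \<in> {0..1} \<Longrightarrow> z \<in> K \<Longrightarrow>
      norm (g t z - (\<Sum>k\<le>n. Bernstein n k t *\<^sub>R g (real k / real n) z)) \<le> \<epsilon>"
proof -
  have cpt: "compact ({0..1::real} \<times> K)"
    using \<open>compact K\<close> by (intro compact_Times) auto
  have "bounded ((\<lambda>(t, z). g t z) ` ({0..1} \<times> K))"
    using compact_continuous_image[OF g cpt] compact_imp_bounded by blast
  then obtain M where "M > 0" and M: "\<And>t z. t \<in> {0..1} \<Longrightarrow> z \<in> K \<Longrightarrow> norm (g t z) \<le> M"
    unfolding bounded_pos by fastforce
  have "uniformly_continuous_on ({0..1} \<times> K) (\<lambda>(t, z). g t z)"
    using compact_uniformly_continuous[OF g cpt] .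
  then obtain d where "d > 0" and d: "\<And>p q. p \<in> {0..1} \<times> K \<Longrightarrow> q \<in> {0..1} \<times> K \<Longrightarrow> dist q p < d \<Longrightarrow>
      dist ((\<lambda>(t, z). g t z) q) ((\<lambda>(t, z). g t z) p) < \<epsilon> / 2"
    unfolding uniformly_continuous_on_def using \<open>\<epsilon> > 0\<close> by (meson half_gt_zero)
  have d: "norm (g t z - g s z) \<le> \<epsilon> / 2"
    if "t \<in> {0..1}" "s \<in> {0..1}" "z \<in> K" "\<bar>t - s\<bar> < d" for t s z
    using d[of "(s, z)" "(t, z)"] that by (auto simp: dist_Pair_Pair dist_norm)
  \<comment> \<open>This makes the contribution \<open>2 * M / (d\<^sup>2 * n)\<close> of the
    distant nodes at most \<epsilon> / 2.\<close>
  obtain n :: nat where n: "real n > 4 * M / (d\<^sup>2 * \<epsilon>)"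
    using reals_Archimedean2 by blast
  moreover have "4 * M / (d\<^sup>2 * \<epsilon>) > 0"
    using \<open>M > 0\<close> \<open>d > 0\<close> \<open>\<epsilon> > 0\<close> by simp
  ultimately have "n > 0"
    by (metis of_nat_0_less_iff order_less_trans)
  show ?thesis
  proof (rule that[OF \<open>n > 0\<close>])
    fix t z assume t: "t \<in> {0..1::real}" and z: "z \<in> K"
    \<comment> \<open>As in Chebyshev's inequality: near nodes are handled by uniform continuity,
      and for distant nodes the trivial bound \<open>2 * M\<close> is absorbed by the quadratic
      term, whose mean is the variance.\<close>
    have le: "norm (g t z - g (k / n) z) \<le> \<epsilon> / 2 + 2 * M / d\<^sup>2 * (t - k / n)\<^sup>2" if "k \<le> n" for k
    proof (cases "\<bar>t - k / n\<bar> < d")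
      case True
      have "0 \<le> 2 * M / d\<^sup>2 * (t - k / n)\<^sup>2"
        using \<open>M > 0\<close> by simp
      with d[of t "k / n" z] t z that \<open>n > 0\<close> True show ?thesis
        by auto
    next
      case False
      then have "d\<^sup>2 \<le> (t - k / n)\<^sup>2"
        using \<open>d > 0\<close> by (metis abs_le_square_iff abs_of_pos linorder_not_less)
      then have "2 * M \<le> 2 * M / d\<^sup>2 * (t - k / n)\<^sup>2"
        using \<open>d > 0\<close> \<open>M > 0\<close> by (simp add: field_simps)
      moreover have "norm (g t z - g (k / n) z) \<le> M + M"
        using M[of t z] M[of "k / n" z] t z that \<open>n > 0\<close>
        by (intro norm_triangle_le_diff add_mono) auto
      ultimately show ?thesis
        using \<open>\<epsilon> > 0\<close> by linarith
    qed
    have "g t z - (\<Sum>k\<le>n. Bernstein n k t *\<^sub>R g (k / n) z) =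
        (\<Sum>k\<le>n. Bernstein n k t *\<^sub>R (g t z - g (k / n) z))"
      by (simp add: scaleR_diff_right sum_subtractf flip: scaleR_sum_left)
    then have "norm (g t z - (\<Sum>k\<le>n. Bernstein n k t *\<^sub>R g (k / n) z)) \<le>
        (\<Sum>k\<le>n. Bernstein n k t * (\<epsilon> / 2 + 2 * M / d\<^sup>2 * (t - k / n)\<^sup>2))"
      using t le by (auto intro!: order.trans[OF norm_sum] sum_mono mult_left_mono
          simp: Bernstein_nonneg simp del: times_divide_eq_left)
    also have "\<dots> = (\<Sum>k\<le>n. \<epsilon> / 2 * Bernstein n k t +
        2 * M / d\<^sup>2 * (Bernstein n k t * (t - k / n)\<^sup>2))"
      by (intro sum.cong) (auto simp: algebra_simps)
    also have "\<dots> = \<epsilon> / 2 + 2 * M / d\<^sup>2 * (t * (1 - t) / n)"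
      unfolding sum.distrib sum_distrib_left[symmetric] Bernstein_variance[OF \<open>n > 0\<close>] by simp
    also have "\<dots> \<le> \<epsilon> / 2 + 2 * M / d\<^sup>2 * (1 / n)"
      using t \<open>M > 0\<close> by (intro add_left_mono mult_left_mono divide_right_mono mult_le_one) auto
    also have "\<dots> \<le> \<epsilon>"
      using n \<open>n > 0\<close> \<open>d > 0\<close> \<open>\<epsilon> > 0\<close> by (simp add: field_simps)
    finally show "norm (g t z - (\<Sum>k\<le>n. Bernstein n k t *\<^sub>R g (k / n) z)) \<le> \<epsilon>" .
  qed
qed

section \<open>Rational functions with prescribed poles\<close>

lemma rational_on_const: "rational_on A (\<lambda>z. c)"
  unfolding rational_on_def by (intro exI[of _ "[:c:]"] exI[of _ 1]) auto

lemma rational_on_add: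
  assumes "rational_on A f" and "rational_on A g"
  shows "rational_on A (\<lambda>z. f z + g z)"
proof -
  obtain P Q P' Q' where "\<forall>z\<in>A. poly Q z \<noteq> 0 \<and> f z = poly P z / poly Q z"
    and "\<forall>z\<in>A. poly Q' z \<noteq> 0 \<and> g z = poly P' z / poly Q' z"
    using assms unfolding rational_on_def by blast
  then show ?thesis
    unfolding rational_on_def
    by (intro exI[of _ "P * Q' + P' * Q"] exI[of _ "Q * Q'"]) (auto simp: field_simps)
qed

lemma rational_on_mult:
  assumes "rational_on A f" and "rational_on A g"
  shows "rational_on A (\<lambda>z. f z * g z)"
proof -
  obtain P Q P' Q' where "\<forall>z\<in>A. poly Q z \<noteq> 0 \<and> f z = poly P z / poly Q z"
    and "\<forall>z\<in>A. poly Q' z \<noteq> 0 \<and> g z = poly P' z / poly Q' z"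
    using assms unfolding rational_on_def by blast
  then show ?thesis
    unfolding rational_on_def
    by (intro exI[of _ "P * P'"] exI[of _ "Q * Q'"]) auto
qed

lemma rational_on_inverse_diff:
  assumes "s \<notin> A"
  shows "rational_on A (\<lambda>z. inverse (z - s))"
  unfolding rational_on_def using assms
  by (intro exI[of _ 1] exI[of _ "[:- s, 1:]"]) (auto simp: field_simps)

lemma rational_on_poly:
  assumes "rational_on A f"
  shows "rational_on A (\<lambda>z. poly p (f z))"
  using assms by (induction p) (auto intro: rational_on_const rational_on_add rational_on_mult)

text \<open>A partial fraction decomposition without polynomial part: the constants sit in the
  \<open>p s\<close>, and the value at infinity is finite.\<close>

definition pole_sum :: "complex set \<Rightarrow> (complex \<Rightarrow> complex poly) \<Rightarrow> complex \<Rightarrow> complex" where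
  "pole_sum S p z = (\<Sum>s\<in>S. poly (p s) (inverse (z - s)))"

lemma rational_on_pole_sum:
  assumes "finite S" and "S \<inter> A = {}"
  shows "rational_on A (pole_sum S p)"
  using assms unfolding pole_sum_def[abs_def]
  by (induction S)
    (auto intro!: rational_on_const rational_on_add rational_on_poly rational_on_inverse_diff)

lemma holomorphic_on_poly_inverse_diff:
  assumes "s \<notin> A"
  shows "(\<lambda>z. poly p (inverse (z - s))) holomorphic_on A"
  using assms by (induction p) (auto intro!: holomorphic_intros)

lemma holomorphic_on_pole_sum:
  assumes "S \<inter> A = {}"
  shows "pole_sum S p holomorphic_on A"
  using assms unfolding pole_sum_def[abs_def]
  by (intro holomorphic_intros holomorphic_on_poly_inverse_diff) auto

text \<open>Near \<open>s\<close> the summand of \<open>s\<close> is a nonconstant polynomial in a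
  quantity tending to infinity, while the other summands converge and cannot cancel it.\<close>

lemma rational_with_poles_exactly_pole_sum:
  assumes "finite S" and deg: "\<And>s. s \<in> S \<Longrightarrow> degree (p s) > 0"
  shows "rational_with_poles_exactly S (pole_sum S p)"
  unfolding rational_with_poles_exactly_def
proof (intro conjI)
  show "rational_on (- S) (pole_sum S p)"
    using assms by (intro rational_on_pole_sum) auto
  \<comment> \<open>A general \<open>T\<close> covers two uses: \<open>T = S\<close> excludes poles
    off \<open>S\<close>, and \<open>T = S - {s}\<close> controls the remaining summands at
    \<open>s\<close>.\<close>
  have tendsto: "(pole_sum T p \<longlongrightarrow> pole_sum T p z) (at z)" if "finite T" "z \<notin> T" for T z
  proof -
    have "continuous_on (- T) (pole_sum T p)"
      by (intro holomorphic_on_imp_continuous_on holomorphic_on_pole_sum) auto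
    then show ?thesis
      using that by (simp add: continuous_on_eq_continuous_at open_Compl finite_imp_closed isCont_def)
  qed
  show "{z. is_pole (pole_sum S p) z} = S"
  proof (intro equalityI subsetI)
    fix z assume "z \<in> {z. is_pole (pole_sum S p) z}"
    with tendsto[OF \<open>finite S\<close>, of z] not_tendsto_and_filterlim_at_infinity show "z \<in> S"
      unfolding is_pole_def by (metis at_neq_bot mem_Collect_eq)
  next
    fix s assume s: "s \<in> S"
    have "((\<lambda>z. z - s) \<longlongrightarrow> 0) (at s)"
      by (simp add: LIM_zero_iff)
    moreover have "eventually (\<lambda>z. z - s \<noteq> 0) (at s)"
      by (simp add: eventually_at_filter)
    ultimately have "filterlim (\<lambda>z. inverse (z - s)) at_infinity (at s)"
      by (intro filterlim_compose[OF filterlim_inverse_at_infinity]) (simp add: filterlim_at)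
    then have "filterlim (\<lambda>z. poly (p s) (inverse (z - s))) at_infinity (at s)"
      using filterlim_compose[OF filterlim_poly_at_infinity[OF deg[OF s]]] by blast
    moreover have "(pole_sum (S - {s}) p \<longlongrightarrow> pole_sum (S - {s}) p s) (at s)"
      using \<open>finite S\<close> by (intro tendsto) auto
    ultimately have "filterlim (\<lambda>z. pole_sum (S - {s}) p z + poly (p s) (inverse (z - s)))
        at_infinity (at s)"
      by (rule tendsto_add_filterlim_at_infinity[rotated])
    also have "(\<lambda>z. pole_sum (S - {s}) p z + poly (p s) (inverse (z - s))) = pole_sum S p"
      using \<open>finite S\<close> s by (auto simp: pole_sum_def sum.remove add.commute)
    finally show "s \<in> {z. is_pole (pole_sum S p) z}"
      by (simp add: is_pole_def)
  qed
  have "((\<lambda>z. inverse (z - s)) \<longlongrightarrow> 0) at_infinity" for s :: complex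
    by (intro filterlim_compose[OF tendsto_inverse_0] filterlim_ident)
      (use tendsto_add_filterlim_at_infinity'[OF filterlim_ident tendsto_const, of "- s"] in simp)
  then have "(pole_sum S p \<longlongrightarrow> (\<Sum>s\<in>S. poly (p s) 0)) at_infinity"
    unfolding pole_sum_def[abs_def] by (intro tendsto_intros)
  then show "\<not> filterlim (pole_sum S p) at_infinity at_infinity"
    using not_tendsto_and_filterlim_at_infinity[of at_infinity] by (metis trivial_limit_at_infinity)
qed

section \<open>Uniform approximation on \<open>K\<close> with poles in \<open>S\<close>\<close>

definition pole_approximable ::
  "complex set \<Rightarrow> complex set \<Rightarrow> (complex \<Rightarrow> complex) \<Rightarrow> bool" where
  "pole_approximable S K g \<longleftrightarrow> (\<forall>e>0. \<exists>p. \<forall>z\<in>K. norm (g z - pole_sum S p z) \<le> e)"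

lemma pole_approximableD:
  assumes "pole_approximable S K g" and "e > 0"
  obtains p where "\<And>z. z \<in> K \<Longrightarrow> norm (g z - pole_sum S p z) \<le> e"
  using assms unfolding pole_approximable_def by meson

lemma pole_approximable_add:
  assumes "pole_approximable S K f" and "pole_approximable S K g"
  shows "pole_approximable S K (\<lambda>z. f z + g z)"
  unfolding pole_approximable_def
proof (intro allI impI)
  fix e :: real assume "e > 0"
  then obtain p q where p: "\<And>z. z \<in> K \<Longrightarrow> norm (f z - pole_sum S p z) \<le> e / 2"
    and q: "\<And>z. z \<in> K \<Longrightarrow> norm (g z - pole_sum S q z) \<le> e / 2"
    using pole_approximableD[OF assms(1)] pole_approximableD[OF assms(2)] by (metis half_gt_zero)
  have "norm (f z + g z - pole_sum S (\<lambda>s. p s + q s) z) \<le> e" if "z \<in> K" for z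
  proof -
    have eq: "f z + g z - pole_sum S (\<lambda>s. p s + q s) z =
        (f z - pole_sum S p z) + (g z - pole_sum S q z)"
      by (simp add: pole_sum_def sum.distrib)
    show ?thesis
      unfolding eq using norm_triangle_mono[OF p[OF that] q[OF that]] by simp
  qed
  then show "\<exists>p. \<forall>z\<in>K. norm (f z + g z - pole_sum S p z) \<le> e"
    by blast
qed

lemma pole_approximable_cmult:
  assumes "pole_approximable S K g"
  shows "pole_approximable S K (\<lambda>z. c * g z)"
  unfolding pole_approximable_def
proof (intro allI impI)
  fix e :: real assume "e > 0"
  \<comment> \<open>The summand 1 in the denominator covers \<open>c = 0\<close>.\<close>
  then obtain p where p: "\<And>z. z \<in> K \<Longrightarrow> norm (g z - pole_sum S p z) \<le> e / (norm c + 1)"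
    using pole_approximableD[OF assms, of "e / (norm c + 1)"] norm_ge_zero[of c]
    by (smt (verit, ccfv_SIG) divide_pos_pos)
  have "norm (c * g z - pole_sum S (\<lambda>s. smult c (p s)) z) \<le> e" if "z \<in> K" for z
  proof -
    have "c * g z - pole_sum S (\<lambda>s. smult c (p s)) z = c * (g z - pole_sum S p z)"
      by (simp add: pole_sum_def sum_distrib_left right_diff_distrib)
    then have "norm (c * g z - pole_sum S (\<lambda>s. smult c (p s)) z) \<le> norm c * (e / (norm c + 1))"
      using p[OF that] by (simp add: norm_mult mult_left_mono del: times_divide_eq_right)
    also have "\<dots> = e * (norm c / (norm c + 1))"
      by simp
    also have "\<dots> \<le> e"
      using \<open>e > 0\<close> by (intro mult_left_le) (auto simp: divide_le_eq add_nonneg_pos)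
    finally show ?thesis .
  qed
  then show "\<exists>p. \<forall>z\<in>K. norm (c * g z - pole_sum S p z) \<le> e"
    by blast
qed

lemma pole_approximable_sum:
  assumes "\<And>i. i \<in> I \<Longrightarrow> pole_approximable S K (g i)"
  shows "pole_approximable S K (\<lambda>z. \<Sum>i\<in>I. g i z)"
proof -
  have "pole_approximable S K (\<lambda>z. 0)"
    unfolding pole_approximable_def by (auto intro!: exI[of _ "\<lambda>s. 0"] simp: pole_sum_def)
  then show ?thesis
    using assms
  proof (induction I rule: infinite_finite_induct)
    case (insert i I)
    then show ?case
      using pole_approximable_add[of S K "g i" "\<lambda>z. \<Sum>i\<in>I. g i z"] by simp
  qed simp_all
qed

text \<open>Together with closure under linear combinations, this passes from single Cauchy kernels
  to integrals of them.\<close>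

lemma pole_approximable_limit:
  assumes "\<And>e. e > 0 \<Longrightarrow> \<exists>h. pole_approximable S K h \<and> (\<forall>z\<in>K. norm (g z - h z) \<le> e)"
  shows "pole_approximable S K g"
  unfolding pole_approximable_def
proof (intro allI impI)
  fix e :: real assume "e > 0"
  then obtain h where h: "pole_approximable S K h" "\<And>z. z \<in> K \<Longrightarrow> norm (g z - h z) \<le> e / 2"
    using assms by (meson half_gt_zero)
  obtain p where p: "\<And>z. z \<in> K \<Longrightarrow> norm (h z - pole_sum S p z) \<le> e / 2"
    using pole_approximableD[OF h(1), of "e / 2"] \<open>e > 0\<close> by auto
  have "norm (g z - pole_sum S p z) \<le> e" if "z \<in> K" for z
    using norm_triangle_ineq[of "g z - h z" "h z - pole_sum S p z"] h(2)[OF that] p[OF that] by simp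
  then show "\<exists>p. \<forall>z\<in>K. norm (g z - pole_sum S p z) \<le> e"
    by blast
qed

text \<open>The geometric series of \<open>1 / (z - y) = 1 / ((z - x) - (y - x))\<close>.\<close>

lemma approximate_inverse_diff:
  fixes x y :: complex
  assumes "norm (y - x) < d" and d: "\<And>z. z \<in> K \<Longrightarrow> d \<le> norm (z - x)" and "e > 0"
  shows "\<exists>q. \<forall>z\<in>K. norm (inverse (z - y) - poly q (inverse (z - x))) < e"
proof -
  define \<rho> where "\<rho> = norm (y - x) / d"
  have "d > 0"
    using assms(1) norm_ge_zero[of "y - x"] by linarith
  then have \<rho>: "0 \<le> \<rho>" "\<rho> < 1"
    using assms(1) by (auto simp: \<rho>_def)
  \<comment> \<open>The remainder of the series after \<open>n\<close> terms will be at most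
    \<open>\<rho> ^ n / (d - norm (y - x))\<close>.\<close>
  have "e * (d - norm (y - x)) > 0"
    using assms by simp
  then obtain n where n: "\<rho> ^ n < e * (d - norm (y - x))"
    using real_arch_pow_inv[OF _ \<rho>(2)] by blast
  define q where "q = (\<Sum>k<n. monom ((y - x) ^ k) (Suc k))"
  have "norm (inverse (z - y) - poly q (inverse (z - x))) < e" if "z \<in> K" for z
  proof -
    define u where "u = inverse (z - x)"
    have zx: "norm (z - x) \<ge> d" and [simp]: "z \<noteq> x"
      using d[OF that] \<open>d > 0\<close> by auto
    then have zy: "norm (z - y) \<ge> d - norm (y - x)"
      using norm_triangle_ineq[of "z - y" "y - x"] by simp
    with assms(1) have [simp]: "z \<noteq> y"
      by auto
    have "poly q u = u * (\<Sum>k<n. ((y - x) * u) ^ k)"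
      by (simp add: q_def poly_sum poly_monom sum_distrib_left power_mult_distrib mult_ac)
    then have "poly q u * (1 - (y - x) * u) = u * (1 - ((y - x) * u) ^ n)"
      by (simp add: one_diff_power_eq)
    also have "1 - (y - x) * u = (z - y) * u"
      by (simp add: u_def field_simps)
    finally have "poly q u * (z - y) = 1 - ((y - x) * u) ^ n"
      by (simp add: u_def)
    then have "inverse (z - y) - poly q u = ((y - x) * u) ^ n / (z - y)"
      by (simp add: field_simps)
    then have "norm (inverse (z - y) - poly q u) = (norm (y - x) * norm u) ^ n / norm (z - y)"
      by (simp add: norm_divide norm_power norm_mult)
    also have "\<dots> \<le> \<rho> ^ n / (d - norm (y - x))"
    proof (intro frac_le power_mono zy)
      have "norm u \<le> inverse d"
        using zx \<open>d > 0\<close> by (simp add: u_def norm_inverse le_imp_inverse_le)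
      then show "norm (y - x) * norm u \<le> \<rho>"
        unfolding \<rho>_def divide_inverse by (intro mult_left_mono) auto
    qed (use assms(1) \<rho> in auto)
    also have "\<dots> < e"
      using n assms(1) by (simp add: field_simps)
    finally show ?thesis
      by (simp add: u_def)
  qed
  then show ?thesis
    by blast
qed

text \<open>Compose \<open>p\<close> with an approximation of the single kernel; uniform continuity
  of \<open>p\<close> on a disc containing all values involved controls the error.\<close>

lemma approximate_poly_inverse_diff:
  fixes x y :: complex
  assumes "norm (y - x) < d" and d: "\<And>z. z \<in> K \<Longrightarrow> d \<le> norm (z - x)" and "e > 0"
  shows "\<exists>q. \<forall>z\<in>K. norm (poly p (inverse (z - y)) - poly q (inverse (z - x))) < e"
proof -
  \<comment> \<open>The inverse bounds the exact kernel on \<open>K\<close>; the extra 1 leaves room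
    for its approximation, whose error is kept below 1.\<close>
  define M where "M = inverse (d - norm (y - x)) + 1"
  have "uniformly_continuous_on (cball 0 M) (poly p)"
    by (intro compact_uniformly_continuous continuous_intros) auto
  then obtain \<eta> where "\<eta> > 0" and \<eta>: "\<And>u v. u \<in> cball 0 M \<Longrightarrow> v \<in> cball 0 M \<Longrightarrow> dist v u < \<eta> \<Longrightarrow>
      dist (poly p v) (poly p u) < e"
    unfolding uniformly_continuous_on_def using \<open>e > 0\<close> by meson
  obtain q where q: "\<And>z. z \<in> K \<Longrightarrow> norm (inverse (z - y) - poly q (inverse (z - x))) < min \<eta> 1"
    using approximate_inverse_diff[OF assms(1) d, of K "min \<eta> 1"] \<open>\<eta> > 0\<close> by auto
  have "norm (poly p (inverse (z - y)) - poly (pcompose p q) (inverse (z - x))) < e" if "z \<in> K" for z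
  proof -
    let ?u = "inverse (z - y)" and ?v = "poly q (inverse (z - x))"
    have "norm (z - y) \<ge> d - norm (y - x)"
      using d[OF that] norm_triangle_ineq[of "z - y" "y - x"] by simp
    then have u: "norm ?u \<le> M - 1"
      using assms(1) by (simp add: M_def norm_inverse le_imp_inverse_le)
    have "norm ?v \<le> norm ?u + norm (?u - ?v)"
      using norm_triangle_ineq2[of ?v ?u] by (simp add: norm_minus_commute)
    then have "norm ?v \<le> M"
      using u q[OF that] by linarith
    with u \<eta>[of ?v ?u] q[OF that] show ?thesis
      by (simp add: dist_norm poly_pcompose)
  qed
  then show ?thesis
    by blast
qed

text \<open>Pole pushing: the pole moves from \<open>w\<close> to \<open>s\<close> through a
  connected set that avoids \<open>K\<close>, by short steps within which the geometric series
  converges on \<open>K\<close>.\<close>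

lemma pole_approximable_inverse_diff:
  assumes "compact K" and "finite S" and "s \<in> S" and "connected_component (- K) w s"
  shows "pole_approximable S K (\<lambda>z. inverse (z - w))"
proof -
  obtain C where C: "connected C" "C \<subseteq> - K" "w \<in> C" "s \<in> C"
    using assms(4) unfolding connected_component_def by blast
  \<comment> \<open>Quantifying over all polynomials \<open>p\<close> makes the property transitive:
    after one step the simple kernel has become a polynomial in the next kernel.\<close>
  define P where "P v \<longleftrightarrow> (\<forall>p. \<forall>e>0. \<exists>q. \<forall>z\<in>K.
      norm (poly p (inverse (z - v)) - poly q (inverse (z - s))) < e)" for v
  have "P w"
  proof (rule connected_induction_simple[OF C(1,4,3)])
    show "P s"
      unfolding P_def by (metis cancel_comm_monoid_add_class.diff_cancel norm_zero)
  next
    fix a assume "a \<in> C"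
    then obtain d where "d > 0" and d: "ball a d \<subseteq> - K"
      using C(2) compact_imp_closed[OF \<open>compact K\<close>]
      unfolding closed_def open_contains_ball by blast
    \<comment> \<open>The radius \<open>d / 3\<close> is chosen so that two points of the small ball
      are less than \<open>2 * d / 3\<close> apart, while \<open>K\<close> stays at least
      \<open>2 * d / 3\<close> away from each of them.\<close>
    have "P y" if xy: "x \<in> C \<inter> ball a (d / 3)" "y \<in> C \<inter> ball a (d / 3)" and "P x" for x y
      unfolding P_def
    proof (intro allI impI)
      fix p and e :: real assume "e > 0"
      have "norm (y - x) < 2 * d / 3"
        using xy dist_triangle_lt[of x a y] dist_triangle_less_add[of y a "d / 3" x "d / 3"]
        by (simp add: dist_norm norm_minus_commute)
      moreover have "2 * d / 3 \<le> norm (z - x)" if "z \<in> K" for z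
      proof -
        have "d \<le> dist a z"
          using d that by (auto simp: subset_eq not_less)
        then show ?thesis
          using xy dist_triangle[of a z x] by (simp add: dist_norm norm_minus_commute)
      qed
      ultimately obtain q where q: "\<And>z. z \<in> K \<Longrightarrow>
          norm (poly p (inverse (z - y)) - poly q (inverse (z - x))) < e / 2"
        using approximate_poly_inverse_diff[of y x "2 * d / 3" K "e / 2" p] \<open>e > 0\<close> by auto
      obtain q' where q': "\<And>z. z \<in> K \<Longrightarrow>
          norm (poly q (inverse (z - x)) - poly q' (inverse (z - s))) < e / 2"
        using \<open>P x\<close> \<open>e > 0\<close> unfolding P_def by (meson half_gt_zero)
      have "norm (poly p (inverse (z - y)) - poly q' (inverse (z - s))) < e" if "z \<in> K" for z
        using norm_diff_triangle_less[OF q[OF that] q'[OF that]] by simp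
      then show "\<exists>q. \<forall>z\<in>K. norm (poly p (inverse (z - y)) - poly q (inverse (z - s))) < e"
        by blast
    qed
    moreover have "openin (top_of_set C) (C \<inter> ball a (d / 3))"
      by (simp add: openin_open_Int)
    moreover have "a \<in> C \<inter> ball a (d / 3)"
      using \<open>a \<in> C\<close> \<open>d > 0\<close> by simp
    ultimately show "\<exists>T. openin (top_of_set C) T \<and> a \<in> T \<and> (\<forall>x\<in>T. \<forall>y\<in>T. P x \<longrightarrow> P y)"
      by blast
  qed
  show ?thesis
    unfolding pole_approximable_def
  proof (intro allI impI)
    fix e :: real assume "e > 0"
    then obtain q where q: "\<And>z. z \<in> K \<Longrightarrow>
        norm (poly [:0, 1:] (inverse (z - w)) - poly q (inverse (z - s))) < e"
      using \<open>P w\<close> unfolding P_def by meson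
    have "pole_sum S (\<lambda>v. if v = s then q else 0) z = poly q (inverse (z - s))" for z
      using assms(2,3) by (simp add: pole_sum_def if_distrib if_distribR cong: if_cong)
    with q show "\<exists>p. \<forall>z\<in>K. norm (inverse (z - w) - pole_sum S p z) \<le> e"
      by (intro exI[of _ "\<lambda>v. if v = s then q else 0"]) (auto intro: less_imp_le)
  qed
qed

section \<open>Runge's theorem\<close>

lemma divide_diff_eq_inverse_diff: "c / (w - z) = - c * inverse (z - w)" for c w z :: "'a::field"
  by (metis divide_inverse inverse_minus_eq minus_diff_eq minus_mult_minus)

section \<open>Cauchy transforms of segments\<close>

lemma has_integral_contour_integral_linepath:
  assumes "continuous_on (closed_segment a b) h"
  shows "((\<lambda>t. h (linepath a b t) * (b - a)) has_integral contour_integral (linepath a b) h) {0..1}"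
  using contour_integrable_continuous_linepath[OF assms] has_contour_integral_integral
    has_contour_integral_linepath by blast

lemma linepath_in_closed_segment: "t \<in> {0..1} \<Longrightarrow> linepath a b t \<in> closed_segment a b"
  by (metis image_eqI linepath_image_01)

lemma continuous_on_Cauchy_kernel:
  fixes g :: "complex \<Rightarrow> complex"
  assumes "continuous_on (closed_segment a b) g" and "closed_segment a b \<inter> K = {}"
  shows "continuous_on ({0..1} \<times> K) (\<lambda>(t, z). g (linepath a b t) / (linepath a b t - z) * (b - a))"
proof -
  have "continuous_on ({0..1} \<times> K) (\<lambda>p. linepath a b (fst p))"
    unfolding linepath_def by (intro continuous_intros)
  moreover from this have "continuous_on ({0..1} \<times> K) (\<lambda>p. g (linepath a b (fst p)))"
    by (rule continuous_on_compose2[OF assms(1)]) (auto simp: linepath_in_closed_segment)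
  moreover have "linepath a b (fst p) - snd p \<noteq> 0" if "p \<in> {0..1} \<times> K" for p
    using linepath_in_closed_segment[of "fst p" a b] that assms(2) by auto
  ultimately show ?thesis
    unfolding case_prod_unfold by (intro continuous_intros) auto
qed

lemma continuous_on_Cauchy_integrand:
  fixes g :: "complex \<Rightarrow> complex"
  assumes "continuous_on (closed_segment a b) g" and "z \<notin> closed_segment a b"
  shows "continuous_on (closed_segment a b) (\<lambda>w. g w / (w - z))"
  using assms by (intro continuous_intros) auto

text \<open>Needed to extend Cauchy's formula from interiors of grid squares to points of
  \<open>K\<close> on the grid lines.\<close>

lemma continuous_on_Cauchy_transform:
  assumes "continuous_on (closed_segment a b) g"
  shows "continuous_on (- closed_segment a b)
    (\<lambda>z. contour_integral (linepath a b) (\<lambda>w. g w / (w - z)))"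
proof -
  have "continuous_on ((- closed_segment a b) \<times> cbox 0 1)
      (\<lambda>p. (\<lambda>(t, z). g (linepath a b t) / (linepath a b t - z) * (b - a)) (prod.swap p))"
    by (rule continuous_on_compose2[OF continuous_on_Cauchy_kernel[OF assms, of "- closed_segment a b"]
          continuous_on_swap]) auto
  then have "continuous_on ((- closed_segment a b) \<times> cbox 0 1)
      (\<lambda>(z, t). g (linepath a b t) / (linepath a b t - z) * (b - a))"
    by (simp add: case_prod_unfold)
  then have "continuous_on (- closed_segment a b)
      (\<lambda>z. integral (cbox 0 1) (\<lambda>t. g (linepath a b t) / (linepath a b t - z) * (b - a)))"
    by (rule integral_continuous_on_param)
  then show ?thesis
  proof (rule continuous_on_eq)
    fix z assume "z \<in> - closed_segment a b"
    then have "continuous_on (closed_segment a b) (\<lambda>w. g w / (w - z))"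
      by (intro continuous_on_Cauchy_integrand assms) auto
    from has_integral_contour_integral_linepath[OF this]
    show "integral (cbox 0 1) (\<lambda>t. g (linepath a b t) / (linepath a b t - z) * (b - a)) =
        contour_integral (linepath a b) (\<lambda>w. g w / (w - z))"
      by (simp only: box_real integral_unique)
  qed
qed

text \<open>Bernstein approximation of the integrand in the path parameter, uniformly in
  \<open>z\<close>, turns the integral into a finite combination of Cauchy kernels with poles on the
  segment. The parameter interval has length 1, so integration does not enlarge the error.\<close>

lemma pole_approximable_Cauchy_transform:
  assumes "compact K" and g: "continuous_on (closed_segment a b) g"
    and disj: "closed_segment a b \<inter> K = {}"
    and approx: "\<And>w. w \<in> closed_segment a b \<Longrightarrow> pole_approximable S K (\<lambda>z. inverse (z - w))"
  shows "pole_approximable S K (\<lambda>z. contour_integral (linepath a b) (\<lambda>w. g w / (w - z)))"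
proof (rule pole_approximable_limit)
  fix e :: real assume "e > 0"
  define G where "G t z = g (linepath a b t) / (linepath a b t - z) * (b - a)" for t z
  have "continuous_on ({0..1} \<times> K) (\<lambda>(t, z). G t z)"
    unfolding G_def by (rule continuous_on_Cauchy_kernel[OF g disj])
  from Bernstein_approximation[OF \<open>compact K\<close> this \<open>e > 0\<close>]
  obtain n where "n > 0" and n: "\<And>t z. t \<in> {0..1} \<Longrightarrow> z \<in> K \<Longrightarrow>
      norm (G t z - (\<Sum>k\<le>n. Bernstein n k t *\<^sub>R G (real k / real n) z)) \<le> e"
    by blast
  define h where "h z = (\<Sum>k\<le>n. integral {0..1} (Bernstein n k) *\<^sub>R G (real k / real n) z)" for z
  have B: "(Bernstein n k has_integral integral {0..1} (Bernstein n k)) {0..1}" for k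
    unfolding Bernstein_def[abs_def]
    by (intro integrable_integral integrable_continuous_real continuous_intros)
  have "norm (contour_integral (linepath a b) (\<lambda>w. g w / (w - z)) - h z) \<le> e" if "z \<in> K" for z
  proof -
    have "((\<lambda>t. G t z) has_integral contour_integral (linepath a b) (\<lambda>w. g w / (w - z))) {0..1}"
      unfolding G_def using that disj
      by (intro has_integral_contour_integral_linepath continuous_on_Cauchy_integrand g) auto
    moreover have "((\<lambda>t. \<Sum>k\<le>n. Bernstein n k t *\<^sub>R G (real k / real n) z) has_integral h z) {0..1}"
      unfolding h_def by (intro has_integral_sum has_integral_scaleR_left B) auto
    ultimately have "((\<lambda>t. G t z - (\<Sum>k\<le>n. Bernstein n k t *\<^sub>R G (real k / real n) z)) has_integral
        contour_integral (linepath a b) (\<lambda>w. g w / (w - z)) - h z) (cbox 0 1)"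
      by (simp add: has_integral_diff)
    from has_integral_bound[OF _ this, of e] show ?thesis
      using n[OF _ that] \<open>e > 0\<close> by simp
  qed
  moreover have "pole_approximable S K h"
  proof -
    have h_eq: "h = (\<lambda>z. \<Sum>k\<le>n. (- of_real (integral {0..1} (Bernstein n k)) *
        g (linepath a b (k / n)) * (b - a)) * inverse (z - linepath a b (k / n)))"
      unfolding h_def[abs_def] G_def scaleR_conv_of_real
      by (intro ext sum.cong) (simp_all add: divide_diff_eq_inverse_diff[of "g _"])
    have "linepath a b (real k / real n) \<in> closed_segment a b" if "k \<le> n" for k
      using that \<open>n > 0\<close> by (intro linepath_in_closed_segment) auto
    then show ?thesis
      unfolding h_eq by (intro pole_approximable_sum pole_approximable_cmult approx) auto
  qed
  ultimately show "\<exists>h. pole_approximable S K h \<and>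
      (\<forall>z\<in>K. norm (contour_integral (linepath a b) (\<lambda>w. g w / (w - z)) - h z) \<le> e)"
    by blast
qed

text \<open>The top and left sides are reversed so that all sides point in increasing coordinate
  direction. An edge shared by two neighbouring squares then gives literally the same integral in
  both.\<close>

lemma contour_integral_rectpath:
  assumes "continuous_on (path_image (rectpath a1 a3)) h"
    and a2: "a2 = Complex (Re a3) (Im a1)" and a4: "a4 = Complex (Re a1) (Im a3)"
  shows "contour_integral (rectpath a1 a3) h =
    contour_integral (linepath a1 a2) h + contour_integral (linepath a2 a3) h
    - contour_integral (linepath a4 a3) h - contour_integral (linepath a1 a4) h"
proof -
  have "path_image (rectpath a1 a3) =
      closed_segment a1 a2 \<union> closed_segment a2 a3 \<union> closed_segment a3 a4 \<union> closed_segment a4 a1"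
    by (simp add: rectpath_def Let_def path_image_join a2 a4 Un_assoc)
  with assms(1) have c: "continuous_on (closed_segment a1 a2) h" "continuous_on (closed_segment a2 a3) h"
    "continuous_on (closed_segment a3 a4) h" "continuous_on (closed_segment a4 a1) h"
    by (auto elim: continuous_on_subset)
  then show ?thesis
    using contour_integral_reverse_linepath[OF c(3)] contour_integral_reverse_linepath[OF c(4)]
    by (simp add: rectpath_def Let_def contour_integrable_continuous_linepath
        flip: a2 a4)
qed

text \<open>Discrete telescoping: what \<open>A\<close> and its shift have in common cancels, and
  only the boundary survives. Here \<sigma> will be the passage from a grid square to its
  neighbour.\<close>

lemma sum_diff_shift:
  fixes f :: "'a \<Rightarrow> 'b::comm_ring_1"
  assumes "finite A" and "inj_on \<sigma> A"
  shows "(\<Sum>x\<in>A. f x - f (\<sigma> x)) = (\<Sum>x\<in>sym_diff A (\<sigma> ` A). (if x \<in> A then 1 else - 1) * f x)"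
proof -
  have "(\<Sum>x\<in>A. f x - f (\<sigma> x)) = sum f A - sum f (\<sigma> ` A)"
    using assms by (simp add: sum_subtractf sum.reindex o_def)
  also have "\<dots> = sum f (A - \<sigma> ` A) - sum f (\<sigma> ` A - A)"
    using assms sum.Int_Diff[of A f "\<sigma> ` A"] sum.Int_Diff[of "\<sigma> ` A" f A] by (simp add: Int_commute)
  also have "\<dots> = (\<Sum>x\<in>A - \<sigma> ` A. (if x \<in> A then 1 else - 1) * f x) +
      (\<Sum>x\<in>\<sigma> ` A - A. (if x \<in> A then 1 else - 1) * f x)"
    by (simp add: sum_negf)
  also have "\<dots> = (\<Sum>x\<in>sym_diff A (\<sigma> ` A). (if x \<in> A then 1 else - 1) * f x)"
    using assms by (intro sum.union_disjoint[symmetric]) auto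
  finally show ?thesis .
qed

text \<open>
  Sum Cauchy's formula over the closed squares of a fine grid that meet \<open>K\<close>. The integrals over
  an edge shared by two of these squares cancel, and an edge belonging to only one of them also
  belongs to a square that misses \<open>K\<close>.
\<close>

lemma Cauchy_formula_grid:
  assumes "compact K" and "open U" and "K \<subseteq> U" and g: "g holomorphic_on U"
  obtains I :: "(bool \<times> int \<times> int) set" and a b c :: "bool \<times> int \<times> int \<Rightarrow> complex"
  where "finite I" and "\<And>i. i \<in> I \<Longrightarrow> closed_segment (a i) (b i) \<subseteq> U - K"
    and "\<And>z. z \<in> K \<Longrightarrow>
      (\<Sum>i\<in>I. c i * contour_integral (linepath (a i) (b i)) (\<lambda>w. g w / (w - z))) = 2 * pi * \<i> * g z"
proof -
  obtain r where "r > 0" and r: "(\<Union>x\<in>K. cball x r) \<subseteq> U"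
    using compact_subset_open_imp_cball_epsilon_subset[OF assms(1-3)] by blast
  \<comment> \<open>Two points of a square of side \<delta> differ by at most
    \<open>2 * \<delta> = r\<close>, so a square that meets \<open>K\<close> lies in
    \<open>U\<close>.\<close>
  define \<delta> where "\<delta> = r / 2"
  have "\<delta> > 0"
    using \<open>r > 0\<close> by (simp add: \<delta>_def)
  define pt where "pt m n = Complex (\<delta> * of_int m) (\<delta> * of_int n)" for m n
  define Q where "Q = (\<lambda>(m, n). cbox (pt m n) (pt (m + 1) (n + 1)))"
  define A where "A = {x. Q x \<inter> K \<noteq> {}}"
  \<comment> \<open>With edges named by their lower left end point, the top side of square
    \<open>x\<close> is the horizontal edge \<open>\<sigma> x\<close>, and its right side is the
    vertical edge \<open>\<tau> x\<close>.\<close>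
  define \<sigma> where "\<sigma> = (\<lambda>(m, n). (m, n + 1) :: int \<times> int)"
  define \<tau> where "\<tau> = (\<lambda>(m, n). (m + 1, n) :: int \<times> int)"
  have mem_Q: "z \<in> Q (m, n) \<longleftrightarrow> \<delta> * of_int m \<le> Re z \<and> Re z \<le> \<delta> * of_int (m + 1) \<and>
      \<delta> * of_int n \<le> Im z \<and> Im z \<le> \<delta> * of_int (n + 1)" for z m n
    by (auto simp: Q_def pt_def in_cbox_complex_iff)
  have "finite A"
  proof -
    obtain M where M: "\<And>z. z \<in> K \<Longrightarrow> norm z \<le> M"
      using compact_imp_bounded[OF \<open>compact K\<close>] unfolding bounded_iff by blast
    have bnd: "m \<in> {- \<lceil>M / \<delta>\<rceil> - 1..\<lceil>M / \<delta>\<rceil>}"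
      if "\<delta> * of_int m \<le> x" "x \<le> \<delta> * of_int (m + 1)" "\<bar>x\<bar> \<le> M" for x m
    proof -
      have "of_int m \<le> M / \<delta>" "- (M / \<delta>) \<le> of_int (m + 1)"
        using that \<open>\<delta> > 0\<close> by (auto simp: field_simps)
      then show ?thesis
        by (auto simp: le_ceiling_iff; linarith)
    qed
    have "A \<subseteq> {- \<lceil>M / \<delta>\<rceil> - 1..\<lceil>M / \<delta>\<rceil>} \<times> {- \<lceil>M / \<delta>\<rceil> - 1..\<lceil>M / \<delta>\<rceil>}"
    proof
      fix x assume "x \<in> A"
      then obtain m n z where x: "x = (m, n)" "z \<in> Q (m, n)" "z \<in> K"
        unfolding A_def by (cases x) auto
      with bnd[of m "Re z"] bnd[of n "Im z"] M[OF x(3)] abs_Re_le_cmod[of z] abs_Im_le_cmod[of z]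
      show "x \<in> {- \<lceil>M / \<delta>\<rceil> - 1..\<lceil>M / \<delta>\<rceil>} \<times> {- \<lceil>M / \<delta>\<rceil> - 1..\<lceil>M / \<delta>\<rceil>}"
        unfolding mem_Q by auto
    qed
    then show ?thesis
      by (rule finite_subset) auto
  qed
  have Q_sub: "Q x \<subseteq> U" if "x \<in> A" for x
  proof
    fix w assume w: "w \<in> Q x"
    obtain m n z where x: "x = (m, n)" "z \<in> Q (m, n)" "z \<in> K"
      using \<open>x \<in> A\<close> unfolding A_def by (cases x) auto
    have "\<bar>Re (z - w)\<bar> \<le> \<delta>" "\<bar>Im (z - w)\<bar> \<le> \<delta>"
      using w x unfolding x(1) mem_Q by (auto simp: abs_le_iff algebra_simps)
    then have "norm (z - w) \<le> r"
      using cmod_le[of "z - w"] unfolding \<delta>_def by linarith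
    then have "w \<in> cball z r"
      by (simp add: dist_norm)
    then show "w \<in> U"
      using r x(3) by blast
  qed
  define I where "I = (SIGMA d:UNIV. if d then sym_diff A (\<sigma> ` A) else sym_diff A (\<tau> ` A))"
  define a where "a = (\<lambda>(d :: bool, m, n). pt m n)"
  define b where "b = (\<lambda>(d, m, n). if d then pt (m + 1) n else pt m (n + 1))"
  \<comment> \<open>Counterclockwise, bottom and right sides count positively, top and left sides
    negatively. The first factor separates horizontal (\<open>d\<close> true) from vertical edges,
    the second tells which adjacent square belongs to \<open>A\<close>.\<close>
  define c where "c = (\<lambda>(d, x). (if d then 1 else - 1) * (if x \<in> A then 1 else - 1) :: complex)"
  have "finite I"
    using \<open>finite A\<close> by (auto simp: I_def)
  have seg: "closed_segment (a i) (b i) \<subseteq> U - K" if "i \<in> I" for i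
  proof -
    obtain d m n where i: "i = (d, m, n)"
      by (metis prod.collapse)
    \<comment> \<open>The square on the other side of the edge. Of the two squares, the one in
      \<open>A\<close> gives the inclusion in \<open>U\<close>, the other one the disjointness from
      \<open>K\<close>.\<close>
    define y where "y = (if d then (m, n - 1) else (m - 1, n))"
    have *: "closed_segment (a i) (b i) \<subseteq> Q x" if "x = (m, n) \<or> x = y" for x
    proof (rule closed_segment_subset)
      show "a i \<in> Q x" "b i \<in> Q x"
        using that \<open>\<delta> > 0\<close> by (auto simp: i a_def b_def y_def mem_Q pt_def algebra_simps)
      show "convex (Q x)"
        by (simp add: Q_def split: prod.split)
    qed
    have "(m, n) \<in> \<sigma> ` A \<longleftrightarrow> (m, n - 1) \<in> A"
      by (force simp: \<sigma>_def image_iff)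
    moreover have "(m, n) \<in> \<tau> ` A \<longleftrightarrow> (m - 1, n) \<in> A"
      by (force simp: \<tau>_def image_iff)
    ultimately have "(m, n) \<in> A \<and> y \<notin> A \<or> (m, n) \<notin> A \<and> y \<in> A"
      using that by (auto simp: I_def i y_def split: if_splits)
    then show ?thesis
      using *[of "(m, n)"] *[of y] Q_sub[of "(m, n)"] Q_sub[of y] unfolding A_def by blast
  qed
  define \<Gamma> where
    "\<Gamma> z = (\<Sum>i\<in>I. c i * contour_integral (linepath (a i) (b i)) (\<lambda>w. g w / (w - z)))" for z
  \<comment> \<open>Points on edges are avoided at first. A point interior to one square lies in no
    other closed square, so this square contributes Cauchy's integral formula and all others
    contribute 0 by Cauchy's theorem.\<close>
  have interior: "\<Gamma> z = 2 * pi * \<i> * g z"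
    if A0: "(m0, n0) \<in> A" and z: "z \<in> box (pt m0 n0) (pt (m0 + 1) (n0 + 1))" for z m0 n0
  proof -
    define h where "h w = g w / (w - z)" for w
    define H where "H i = contour_integral (linepath (a i) (b i)) h" for i
    have eq0: "x = (m0, n0)" if "z \<in> Q x" for x
    proof -
      obtain m n where x: "x = (m, n)"
        by (cases x)
      have "\<delta> * of_int m0 < \<delta> * of_int (m + 1)" "\<delta> * of_int m < \<delta> * of_int (m0 + 1)"
        "\<delta> * of_int n0 < \<delta> * of_int (n + 1)" "\<delta> * of_int n < \<delta> * of_int (n0 + 1)"
        using z that unfolding x mem_Q by (auto simp: pt_def in_box_complex_iff)
      then show ?thesis
        using \<open>\<delta> > 0\<close> unfolding x mult_less_cancel_left_pos[OF \<open>\<delta> > 0\<close>] of_int_less_iff by auto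
    qed
    have square: "contour_integral (rectpath (pt m n) (pt (m + 1) (n + 1))) h =
          (if (m, n) = (m0, n0) then 2 * pi * \<i> * g z else 0) \<and>
        contour_integral (rectpath (pt m n) (pt (m + 1) (n + 1))) h =
          (H (True, m, n) - H (True, \<sigma> (m, n))) - (H (False, m, n) - H (False, \<tau> (m, n)))"
      if mn: "(m, n) \<in> A" for m n
    proof
      let ?p = "rectpath (pt m n) (pt (m + 1) (n + 1))"
      have le: "Re (pt m n) \<le> Re (pt (m + 1) (n + 1))" "Im (pt m n) \<le> Im (pt (m + 1) (n + 1))"
        using \<open>\<delta> > 0\<close> by (auto simp: pt_def)
      have sub: "path_image ?p \<subseteq> Q (m, n)"
        using path_image_rectpath_subset_cbox[OF le] by (simp add: Q_def)
      have gQ: "g holomorphic_on Q (m, n)"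
        using g Q_sub[OF mn] holomorphic_on_subset by blast
      have notin: "z \<notin> path_image ?p"
      proof
        assume "z \<in> path_image ?p"
        moreover from this have "(m, n) = (m0, n0)"
          using sub eq0 by blast
        ultimately show False
          using z path_image_rectpath_cbox_minus_box[OF le] by auto
      qed
      show "contour_integral ?p h = (if (m, n) = (m0, n0) then 2 * pi * \<i> * g z else 0)"
      proof (cases "(m, n) = (m0, n0)")
        case True
        have "winding_number ?p z = 1"
          using z True by (intro winding_number_rectpath) auto
        moreover have "(h has_contour_integral (2 * pi * \<i> * winding_number ?p z * g z)) ?p"
          unfolding h_def using z True sub notin gQ
          by (intro Cauchy_integral_formula_convex_simple[of "Q (m, n)"])
            (auto simp: Q_def interior_cbox)
        ultimately show ?thesis
          using True by (simp add: contour_integral_unique)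
      next
        case False
        then have "z \<notin> Q (m, n)"
          using eq0 by blast
        then have "h holomorphic_on Q (m, n)"
          unfolding h_def using gQ by (intro holomorphic_intros) auto
        then have "(h has_contour_integral 0) ?p"
          using sub by (intro Cauchy_theorem_convex_simple[of h "Q (m, n)"]) (auto simp: Q_def)
        then show ?thesis
          using False by (auto simp: contour_integral_unique)
      qed
      have "continuous_on (path_image ?p) h"
        unfolding h_def using notin
        by (intro continuous_intros continuous_on_subset[OF holomorphic_on_imp_continuous_on[OF gQ] sub])
          auto
      from contour_integral_rectpath[OF this refl refl]
      show "contour_integral ?p h =
          (H (True, m, n) - H (True, \<sigma> (m, n))) - (H (False, m, n) - H (False, \<tau> (m, n)))"
        by (simp add: H_def a_def b_def \<sigma>_def \<tau>_def pt_def)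
    qed
    have sq: "(\<Sum>x\<in>A. (H (True, x) - H (True, \<sigma> x)) - (H (False, x) - H (False, \<tau> x))) =
        (\<Sum>x\<in>A. if x = (m0, n0) then 2 * pi * \<i> * g z else 0)"
    proof (intro sum.cong refl)
      fix x assume "x \<in> A"
      then show "(H (True, x) - H (True, \<sigma> x)) - (H (False, x) - H (False, \<tau> x)) =
          (if x = (m0, n0) then 2 * pi * \<i> * g z else 0)"
        using square[of "fst x" "snd x"] by auto
    qed
    have "inj \<sigma>" "inj \<tau>"
      by (auto simp: inj_def \<sigma>_def \<tau>_def)
    then have inj: "inj_on \<sigma> A" "inj_on \<tau> A"
      by (auto simp: inj_on_def)
    have "(\<Sum>x\<in>A. (H (True, x) - H (True, \<sigma> x)) - (H (False, x) - H (False, \<tau> x))) =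
        (\<Sum>x\<in>sym_diff A (\<sigma> ` A). (if x \<in> A then 1 else - 1) * H (True, x)) -
        (\<Sum>x\<in>sym_diff A (\<tau> ` A). (if x \<in> A then 1 else - 1) * H (False, x))"
      using sum_diff_shift[OF \<open>finite A\<close> inj(1), of "\<lambda>x. H (True, x)"]
        sum_diff_shift[OF \<open>finite A\<close> inj(2), of "\<lambda>x. H (False, x)"]
      by (subst sum_subtractf) simp
    also have "\<dots> = (\<Sum>d\<in>UNIV. \<Sum>x\<in>(if d then sym_diff A (\<sigma> ` A) else sym_diff A (\<tau> ` A)).
        c (d, x) * H (d, x))"
      by (simp add: UNIV_bool c_def sum_negf)
    also have "\<dots> = (\<Sum>(d, x)\<in>I. c (d, x) * H (d, x))"
      unfolding I_def by (intro sum.Sigma) (auto simp: \<open>finite A\<close>)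
    also have "\<dots> = \<Gamma> z"
      unfolding \<Gamma>_def H_def h_def by (simp add: case_prod_unfold)
    finally show ?thesis
      using sq A0 \<open>finite A\<close> by simp
  qed
  \<comment> \<open>A point of \<open>K\<close> may lie on grid edges, but only on cancelled ones.
    Both sides are therefore continuous there, and the formula follows by a limit from the interior
    of a square in \<open>A\<close>.\<close>
  have "\<Gamma> z = 2 * pi * \<i> * g z" if "z \<in> K" for z
  proof -
    define m where "m = \<lfloor>Re z / \<delta>\<rfloor>"
    define n where "n = \<lfloor>Im z / \<delta>\<rfloor>"
    have "of_int m \<le> Re z / \<delta>" "Re z / \<delta> \<le> of_int (m + 1)"
      "of_int n \<le> Im z / \<delta>" "Im z / \<delta> \<le> of_int (n + 1)"
      unfolding m_def n_def by linarith+
    then have zQ: "z \<in> Q (m, n)"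
      using \<open>\<delta> > 0\<close> by (simp add: mem_Q field_simps)
    then have mn: "(m, n) \<in> A"
      using \<open>z \<in> K\<close> by (auto simp: A_def)
    have "box (pt m n) (pt (m + 1) (n + 1)) \<noteq> {}"
      using \<open>\<delta> > 0\<close> by (auto simp: box_ne_empty Basis_complex_def pt_def)
    then have "z \<in> closure (box (pt m n) (pt (m + 1) (n + 1)))"
      using zQ by (simp add: Q_def closure_box)
    then obtain x where x: "\<And>k. x k \<in> box (pt m n) (pt (m + 1) (n + 1))" "x \<longlonglongrightarrow> z"
      unfolding closure_sequential by blast
    have "isCont (\<lambda>z. contour_integral (linepath (a i) (b i)) (\<lambda>w. g w / (w - z))) z" if "i \<in> I" for i
    proof -
      have "continuous_on (closed_segment (a i) (b i)) g"
        using seg[OF that] g holomorphic_on_imp_continuous_on continuous_on_subset by blast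
      from continuous_on_Cauchy_transform[OF this] show ?thesis
        using seg[OF that] \<open>z \<in> K\<close> by (subst (asm) continuous_on_eq_continuous_at) auto
    qed
    then have "isCont \<Gamma> z"
      unfolding \<Gamma>_def[abs_def] by (intro continuous_intros)
    then have "(\<lambda>k. \<Gamma> (x k)) \<longlonglongrightarrow> \<Gamma> z"
      using x(2) isCont_tendsto_compose by blast
    moreover have "isCont g z"
      using g \<open>open U\<close> \<open>z \<in> K\<close> \<open>K \<subseteq> U\<close> holomorphic_on_imp_continuous_on continuous_on_eq_continuous_at
      by blast
    then have "(\<lambda>k. 2 * pi * \<i> * g (x k)) \<longlonglongrightarrow> 2 * pi * \<i> * g z"
      using x(2) isCont_tendsto_compose by (intro tendsto_intros) blast
    ultimately show ?thesis
      unfolding interior[OF mn x(1)] by (rule LIMSEQ_unique)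
  qed
  with that \<open>finite I\<close> seg show ?thesis
    unfolding \<Gamma>_def by blast
qed

text \<open>Cauchy's formula writes \<open>g\<close> as a combination of kernels with poles on edges
  in \<open>U - K\<close>, and each such pole can be pushed to \<open>S\<close>. An unbounded
  component of \<open>- K\<close> that meets \<open>U\<close> has to supply a point of
  \<open>S\<close> as well, which is why no polynomial part appears.\<close>

theorem Runge:
  assumes "compact K" and "open U" and "K \<subseteq> U" and "g holomorphic_on U" and "finite S"
    and S: "\<And>w. w \<in> U - K \<Longrightarrow> \<exists>s\<in>S. connected_component (- K) w s"
  shows "pole_approximable S K g"
proof (rule Cauchy_formula_grid[OF assms(1-4)])
  fix I :: "(bool \<times> int \<times> int) set" and a b c :: "bool \<times> int \<times> int \<Rightarrow> complex"
  assume "finite I" and seg: "\<And>i. i \<in> I \<Longrightarrow> closed_segment (a i) (b i) \<subseteq> U - K"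
      and eq: "\<And>z. z \<in> K \<Longrightarrow>
        (\<Sum>i\<in>I. c i * contour_integral (linepath (a i) (b i)) (\<lambda>w. g w / (w - z))) = 2 * pi * \<i> * g z"
  define h where "h z = inverse (2 * pi * \<i>) *
    (\<Sum>i\<in>I. c i * contour_integral (linepath (a i) (b i)) (\<lambda>w. g w / (w - z)))" for z
  have "pole_approximable S K h"
    unfolding h_def[abs_def]
  proof (intro pole_approximable_cmult pole_approximable_sum pole_approximable_Cauchy_transform)
    fix i assume i: "i \<in> I"
    show "continuous_on (closed_segment (a i) (b i)) g"
      using seg[OF i] assms(4) holomorphic_on_imp_continuous_on continuous_on_subset by blast
    show "closed_segment (a i) (b i) \<inter> K = {}"
      using seg[OF i] by blast
    show "pole_approximable S K (\<lambda>z. inverse (z - w))" if "w \<in> closed_segment (a i) (b i)" for w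
      using S[of w] seg[OF i] that pole_approximable_inverse_diff[OF assms(1) \<open>finite S\<close>] by blast
  qed (rule \<open>compact K\<close>)
  moreover have "g z = h z" if "z \<in> K" for z
    unfolding h_def eq[OF that] by (simp add: field_simps)
  ultimately show ?thesis
    unfolding pole_approximable_def by simp
qed

section \<open>Analyticity and smoothness in time\<close>

text \<open>Expand each power in the complex Taylor series by the binomial theorem in the real and
  imaginary parts. Cauchy's inequality with a bound common to all \<open>t\<close> makes radius and
  coefficient bound uniform.\<close>

lemma uniformly_analytic_on_holomorphic:
  fixes u :: "'t \<Rightarrow> complex \<Rightarrow> complex"
  assumes "open U" and hol: "\<And>t. t \<in> T \<Longrightarrow> u t holomorphic_on U"
    and bdd: "\<And>K. compact K \<Longrightarrow> K \<subseteq> U \<Longrightarrow> \<exists>B. \<forall>t\<in>T. \<forall>z\<in>K. norm (u t z) \<le> B"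
  shows "uniformly_analytic_on T U u"
  unfolding uniformly_analytic_on_def
proof
  fix x assume "x \<in> U"
  then obtain \<rho> where \<rho>: "\<rho> > 0" "cball x \<rho> \<subseteq> U"
    using \<open>open U\<close> unfolding open_contains_cball by auto
  obtain B where B: "\<And>t z. t \<in> T \<Longrightarrow> z \<in> cball x \<rho> \<Longrightarrow> norm (u t z) \<le> B"
    using bdd[OF compact_cball \<rho>(2)] by blast
  define a where "a t n = (deriv ^^ n) (u t) x / fact n" for t n
  have B0: "B \<ge> 0" if "t \<in> T" for t
    using order.trans[OF norm_ge_zero B[OF that, of x]] \<rho> by auto
  have a: "norm (a t n) \<le> B / \<rho> ^ n" if "t \<in> T" for t n
  proof -
    have h: "u t holomorphic_on cball x \<rho>"
      using hol[OF that] \<rho> holomorphic_on_subset by blast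
    then have "norm ((deriv ^^ n) (u t) x) \<le> fact n * B / \<rho> ^ n"
      using \<rho> B[OF that]
      by (intro Cauchy_inequality holomorphic_on_imp_continuous_on)
        (auto intro: holomorphic_on_subset simp: dist_norm)
    then show ?thesis
      by (simp add: a_def norm_divide field_simps)
  qed
  \<comment> \<open>The coefficient of \<open>p ^ k * q ^ (n - k)\<close> in
    \<open>a t n * (p + \<i> * q) ^ n\<close>, for \<open>k = \<alpha> 1\<close> and
    \<open>n - k = \<alpha> \<i>\<close>.\<close>
  define c where "c t \<alpha> = a t (\<alpha> 1 + \<alpha> \<i>) * of_nat ((\<alpha> 1 + \<alpha> \<i>) choose \<alpha> 1) * \<i> ^ \<alpha> \<i>"
    for t and \<alpha> :: "complex \<Rightarrow> nat"
  \<comment> \<open>The binomial coefficient may cost a factor \<open>2 ^ n\<close>; a quarter of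
    the radius still leaves the decay \<open>(1/2) ^ n\<close>.\<close>
  define r where "r = \<rho> / 4"
  define h where "h = (\<lambda>(n, k) b. if b = 1 then k else if b = \<i> then n - k else (0::nat))"
  have h_bij: "bij_betw h (Sigma UNIV (\<lambda>n. {..n})) multi_indices"
    by (rule bij_betw_byWitness[where f' = "\<lambda>\<alpha>. (\<alpha> 1 + \<alpha> \<i>, \<alpha> 1)"])
      (auto simp: h_def multi_indices_def Basis_complex_def fun_eq_iff)
  have c_le: "norm (c t \<alpha>) * r ^ (\<alpha> 1 + \<alpha> \<i>) \<le> B * (1/2) ^ (\<alpha> 1 + \<alpha> \<i>)"
    if "t \<in> T" for t \<alpha>
  proof -
    let ?n = "\<alpha> 1 + \<alpha> \<i>"
    have "real (?n choose \<alpha> 1) \<le> 2 ^ ?n"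
      using binomial_le_pow2[of ?n "\<alpha> 1"] by (metis of_nat_le_iff of_nat_numeral of_nat_power)
    then have "norm (a t ?n) * real (?n choose \<alpha> 1) \<le> B / \<rho> ^ ?n * 2 ^ ?n"
      using a[OF that, of ?n] \<rho> B0[OF that] by (intro mult_mono) auto
    then have "norm (c t \<alpha>) * r ^ ?n \<le> (B / \<rho> ^ ?n * 2 ^ ?n) * r ^ ?n"
      using \<rho> by (intro mult_right_mono) (auto simp: c_def norm_mult norm_power r_def)
    also have "\<dots> = B * (2 * r / \<rho>) ^ ?n"
      by (simp add: power_mult_distrib power_divide)
    also have "2 * r / \<rho> = 1 / 2"
      using \<rho> by (simp add: r_def)
    finally show ?thesis .
  qed
  have "((\<lambda>\<alpha>. (\<Prod>b\<in>Basis. ((y - x) \<bullet> b) ^ \<alpha> b) *\<^sub>R c t \<alpha>) has_sum u t y) multi_indices"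
    if t: "t \<in> T" and y: "y \<in> ball x r" for t y
  proof -
    define p where "p = Re (y - x)"
    define q where "q = Im (y - x)"
    have yx: "norm (y - x) < r"
      using y by (simp add: dist_norm norm_minus_commute)
    have p: "\<bar>p\<bar> \<le> r" and q: "\<bar>q\<bar> \<le> r"
      using yx abs_Re_le_cmod[of "y - x"] abs_Im_le_cmod[of "y - x"] by (auto simp: p_def q_def)
    define G where "G = (\<lambda>(n, k). of_real (p ^ k * q ^ (n - k)) * (a t n * of_nat (n choose k) * \<i> ^ (n - k)))"
    have eq: "(\<Prod>b\<in>Basis. ((y - x) \<bullet> b) ^ h (n, k) b) *\<^sub>R c t (h (n, k)) = G (n, k)" if "k \<le> n" for n k
      using that by (simp add: h_def Basis_complex_def c_def G_def p_def q_def scaleR_conv_of_real)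
    have inner: "((\<lambda>k. G (n, k)) has_sum (a t n * (y - x) ^ n)) {..n}" for n
    proof -
      have "y - x = of_real p + \<i> * of_real q"
        by (simp add: p_def q_def complex_eq_iff)
      then have "a t n * (y - x) ^ n = (\<Sum>k\<le>n. G (n, k))"
        by (simp add: G_def binomial_ring sum_distrib_left power_mult_distrib algebra_simps)
      then show ?thesis
        by simp
    qed
    have outer: "((\<lambda>n. a t n * (y - x) ^ n) has_sum u t y) UNIV"
    proof (rule norm_summable_imp_has_sum)
      have "norm (a t n * (y - x) ^ n) \<le> B * (1/4) ^ n" for n
      proof -
        have "norm (a t n * (y - x) ^ n) \<le> B / \<rho> ^ n * r ^ n"
          unfolding norm_mult norm_power
          using a[OF t, of n] yx B0[OF t] \<rho> by (intro mult_mono power_mono) auto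
        also have "\<dots> = B * (r / \<rho>) ^ n"
          by (simp add: power_divide)
        also have "r / \<rho> = 1 / 4"
          using \<rho> by (simp add: r_def)
        finally show ?thesis .
      qed
      then show "summable (\<lambda>n. norm (a t n * (y - x) ^ n))"
        by (intro summable_comparison_test'[OF summable_mult[OF summable_geometric],
            where N = 0]) auto
      have "u t holomorphic_on ball x \<rho>"
        using hol[OF t] \<rho> ball_subset_cball holomorphic_on_subset by blast
      moreover have "y \<in> ball x \<rho>"
        using y \<rho> by (auto simp: r_def)
      ultimately show "(\<lambda>n. a t n * (y - x) ^ n) sums u t y"
        unfolding a_def by (rule holomorphic_power_series)
    qed
    have G_le: "norm (G (n, k)) \<le> B * (1/2) ^ n" if "k \<le> n" for n k
    proof -
      have "norm (G (n, k)) \<le> norm (c t (h (n, k))) * r ^ n"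
      proof -
        have "\<bar>p\<bar> ^ k * \<bar>q\<bar> ^ (n - k) \<le> r ^ k * r ^ (n - k)"
          using p q \<rho> by (intro mult_mono power_mono) (auto simp: r_def)
        also have "\<dots> = r ^ n"
          using that by (simp flip: power_add)
        finally have "\<bar>p\<bar> ^ k * \<bar>q\<bar> ^ (n - k) \<le> r ^ n" .
        moreover have "norm (G (n, k)) = norm (c t (h (n, k))) * (\<bar>p\<bar> ^ k * \<bar>q\<bar> ^ (n - k))"
          using that by (simp add: G_def c_def h_def norm_mult norm_power abs_mult power_abs)
        ultimately show ?thesis
          by (simp add: mult_left_mono)
      qed
      also have "\<dots> \<le> B * (1/2) ^ n"
        using c_le[OF t, of "h (n, k)"] that by (simp add: h_def)
      finally show ?thesis .
    qed
    \<comment> \<open>Row \<open>n\<close> has \<open>n + 1\<close> entries of size at most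
      \<open>B * (1/2) ^ n\<close>. Absolute summability over all pairs justifies rearranging the
      Taylor series into a sum over multi-indices.\<close>
    have "(\<lambda>i. norm (G i)) summable_on Sigma UNIV (\<lambda>n. {..n})"
    proof (rule Infinite_Sum.abs_summable_on_Sigma_iff[THEN iffD2], intro conjI ballI)
      have le: "norm (\<Sum>k\<le>n. norm (G (n, k))) \<le> B * (real (Suc n) * (1/2) ^ n)" for n
      proof -
        have "(\<Sum>k\<le>n. norm (G (n, k))) \<le> (\<Sum>k\<le>n. B * (1/2) ^ n)"
          by (intro sum_mono G_le) auto
        then show ?thesis
          by (simp add: sum_nonneg algebra_simps)
      qed
      have "summable (\<lambda>n. B * (real (Suc n) * (1/2) ^ n))"
        using geometric_deriv_sums[of "1/2::real"]
        by (intro summable_mult) (auto simp: sums_iff)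
      then have "summable (\<lambda>n. norm (\<Sum>k\<le>n. norm (G (n, k))))"
        by (rule summable_comparison_test'[where N = 0]) (use le in simp)
      then have "(\<lambda>n. \<Sum>k\<le>n. norm (G (n, k))) summable_on UNIV"
        by (rule norm_summable_imp_summable_on)
      then show "(\<lambda>n. norm (\<Sum>\<^sub>\<infinity>k\<in>{..n}. norm (G (n, k)))) summable_on UNIV"
        by (simp add: sum_nonneg)
    qed auto
    then have "G summable_on Sigma UNIV (\<lambda>n. {..n})"
      by (rule abs_summable_summable)
    with inner outer have "(G has_sum u t y) (Sigma UNIV (\<lambda>n. {..n}))"
      by (intro has_sum_SigmaI)
    then have "((\<lambda>i. (\<Prod>b\<in>Basis. ((y - x) \<bullet> b) ^ h i b) *\<^sub>R c t (h i)) has_sum u t y)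
        (Sigma UNIV (\<lambda>n. {..n}))"
      by (rule has_sum_cong[THEN iffD1, rotated]) (use eq in auto)
    then show ?thesis
      using has_sum_reindex_bij_betw[OF h_bij,
          of "\<lambda>\<alpha>. (\<Prod>b\<in>Basis. ((y - x) \<bullet> b) ^ \<alpha> b) *\<^sub>R c t \<alpha>" "u t y"] by simp
  qed
  moreover have "norm (c t \<alpha>) * r ^ (\<Sum>b\<in>Basis. \<alpha> b) \<le> B" if "t \<in> T" for t \<alpha>
  proof -
    have "B * (1/2) ^ (\<alpha> 1 + \<alpha> \<i>) \<le> B"
      using B0[OF that] by (intro mult_left_le power_le_one) auto
    with c_le[OF that, of \<alpha>] show ?thesis
      by (simp add: Basis_complex_def)
  qed
  ultimately show "\<exists>r>0. \<exists>M c. \<forall>t\<in>T.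
      (\<forall>\<alpha>\<in>multi_indices. norm (c t \<alpha>) * r ^ (\<Sum>b\<in>Basis. \<alpha> b) \<le> M) \<and>
      (\<forall>y\<in>ball x r. ((\<lambda>\<alpha>. (\<Prod>b\<in>Basis. ((y - x) \<bullet> b) ^ \<alpha> b) *\<^sub>R c t \<alpha>) has_sum u t y)
        multi_indices)"
    using \<rho> by (intro exI[of _ r] conjI exI[of _ B] exI[of _ c]) (auto simp: r_def)
qed

section \<open>Polynomials in time with holomorphic coefficients\<close>

definition time_poly_sum ::
  "(real poly \<times> (complex \<Rightarrow> complex)) list \<Rightarrow> real \<Rightarrow> complex \<Rightarrow> complex" where
  "time_poly_sum L t z = (\<Sum>(b, q)\<leftarrow>L. of_real (poly b t) * q z)"

lemma time_poly_sum_simps [simp]: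
  "time_poly_sum [] t z = 0"
  "time_poly_sum ((b, q) # L) t z = of_real (poly b t) * q z + time_poly_sum L t z"
  by (simp_all add: time_poly_sum_def)

lemma holomorphic_on_time_poly_sum:
  assumes "\<forall>(b, q)\<in>set L. q holomorphic_on U"
  shows "time_poly_sum L t holomorphic_on U"
  using assms
proof (induction L)
  case (Cons p L)
  then show ?case
    by (cases p) (auto intro!: holomorphic_intros)
qed (auto simp: time_poly_sum_def[abs_def])

text \<open>The product rule in direction \<open>(h, w)\<close>, with the scalars moved into the
  holomorphic factors. The result is again a list of the same kind, so differentiation can be
  iterated.\<close>

definition time_poly_sum_deriv where
  "time_poly_sum_deriv L = (\<lambda>(h, w).
     concat (map (\<lambda>(b, q). [(pderiv b, \<lambda>z. of_real h * q z), (b, \<lambda>z. w * deriv q z)]) L))"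

lemma has_derivative_time_poly_sum:
  assumes "open U" and "\<forall>(b, q)\<in>set L. q holomorphic_on U" and "z \<in> U"
  shows "((\<lambda>(t, z). time_poly_sum L t z) has_derivative
     (\<lambda>v. time_poly_sum (time_poly_sum_deriv L v) t z)) (at (t, z) within A)"
  using assms(2)
proof (induction L)
  case (Cons p L)
  obtain b q where p: "p = (b, q)"
    by (cases p)
  have q: "(q has_field_derivative deriv q z) (at (snd (t, z)))"
    using Cons.prems p assms(1,3) holomorphic_derivI by fastforce
  have b: "(poly b has_field_derivative poly (pderiv b) t) (at (fst (t, z)))"
    by simp
  have "((\<lambda>p. of_real (poly b (fst p)) * q (snd p)) has_derivative
      (\<lambda>v. of_real (poly b t) * (deriv q z * snd v) + of_real (poly (pderiv b) t * fst v) * q z))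
      (at (t, z) within A)"
    using has_derivative_compose[OF has_derivative_fst[OF has_derivative_ident]
        b[THEN has_field_derivative_imp_has_derivative], where s = A]
      has_derivative_compose[OF has_derivative_snd[OF has_derivative_ident]
        q[THEN has_field_derivative_imp_has_derivative], where s = A]
    by (auto intro!: derivative_eq_intros)
  from has_derivative_add[OF this Cons.IH] Cons.prems show ?case
    by (simp add: p time_poly_sum_deriv_def case_prod_unfold algebra_simps)
qed (auto simp: time_poly_sum_deriv_def case_prod_unfold)

text \<open>The class is closed under directional derivatives, which is exactly the invariant for
  coinduction.\<close>

lemma smooth_on_time_poly_sum:
  assumes "open U" and "\<forall>(b, q)\<in>set L. q holomorphic_on U"
  shows "smooth_on (T \<times> U) (\<lambda>(t, z). time_poly_sum L t z)"
  using assms(2)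
proof (coinduction arbitrary: L)
  case smooth_on
  have "\<forall>(b, q)\<in>set (time_poly_sum_deriv L v). q holomorphic_on U" for v
    using smooth_on assms(1)
    by (fastforce simp: time_poly_sum_deriv_def intro!: holomorphic_intros split: prod.splits)
  moreover have "((\<lambda>(t, z). time_poly_sum L t z) has_derivative
      (\<lambda>v. case x of (t, z) \<Rightarrow> time_poly_sum (time_poly_sum_deriv L v) t z)) (at x within T \<times> U)"
    if "x \<in> T \<times> U" for x
    using has_derivative_time_poly_sum[OF assms(1) smooth_on, of "snd x" "fst x"] that by auto
  ultimately show ?case
    by (intro exI[of _ "\<lambda>(t, z). time_poly_sum L t z"]
        exI[of _ "\<lambda>x v. case x of (t, z) \<Rightarrow> time_poly_sum (time_poly_sum_deriv L v) t z"]) blast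
qed

text \<open>Stated for any \<open>u\<close> that agrees with the sum on [0,1], since iterates of
  \<open>time_deriv\<close> are known to have this form only there.\<close>

lemma time_deriv_time_poly_sum:
  assumes "\<And>s z. s \<in> {0..1} \<Longrightarrow> u s z = time_poly_sum L s z" and t: "t \<in> {0..1}"
  shows "time_deriv u t z = time_poly_sum (map (apfst pderiv) L) t z"
proof -
  have "((\<lambda>s. time_poly_sum L s z) has_vector_derivative time_poly_sum (map (apfst pderiv) L) t z)
      (at t within {0..1})"
  proof (induction L)
    case (Cons p L)
    obtain b q where p: "p = (b, q)"
      by (cases p)
    have b: "(poly b has_real_derivative poly (pderiv b) t) (at t within {0..1})"
      by (rule has_field_derivative_at_within[OF poly_DERIV])
    have "((\<lambda>s. of_real (poly b s) * q z) has_vector_derivative of_real (poly (pderiv b) t) * q z)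
        (at t within {0..1})"
      by (intro derivative_intros has_vector_derivative_of_real b)
    from has_vector_derivative_add[OF this Cons.IH] show ?case
      by (simp add: p)
  qed auto
  then have "((\<lambda>s. u s z) has_vector_derivative time_poly_sum (map (apfst pderiv) L) t z)
      (at t within {0..1})"
    by (rule has_vector_derivative_transform[OF t, rotated]) (use assms in auto)
  then show ?thesis
    unfolding time_deriv_def using t
    by (intro vector_derivative_within_closed_interval) auto
qed

text \<open>Every time derivative is again such a sum, holomorphic in space and, by joint
  continuity, bounded on [0,1] times a compact set.\<close>

lemma smooth_time_analytic_on_time_poly_sum:
  assumes "open U" and L: "\<forall>(b, q)\<in>set L. q holomorphic_on U"
  shows "smooth_time_analytic_on U (time_poly_sum L)"
proof -
  have "uniformly_analytic_on {0..1} U ((time_deriv ^^ k) (time_poly_sum L))" for k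
  proof -
    let ?L = "((map (apfst pderiv)) ^^ k) L"
    have eq: "(time_deriv ^^ k) (time_poly_sum L) t z = time_poly_sum ?L t z" if "t \<in> {0..1}" for t z
      using that
    proof (induction k arbitrary: t z)
      case (Suc k)
      then show ?case
        using time_deriv_time_poly_sum[of "(time_deriv ^^ k) (time_poly_sum L)"
            "(map (apfst pderiv) ^^ k) L" t z] by simp
    qed simp
    have hol: "\<forall>(b, q)\<in>set ?L. q holomorphic_on U"
      by (induction k) (use L in auto)
    show ?thesis
    proof (rule uniformly_analytic_on_holomorphic[OF \<open>open U\<close>])
      fix t :: real assume "t \<in> {0..1}"
      then have "(time_deriv ^^ k) (time_poly_sum L) t = time_poly_sum ?L t"
        using eq by auto
      then show "(time_deriv ^^ k) (time_poly_sum L) t holomorphic_on U"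
        using holomorphic_on_time_poly_sum[OF hol] by simp
    next
      fix K assume K: "compact K" "K \<subseteq> U"
      have "continuous_on ({0..1} \<times> K) (\<lambda>(t, z). time_poly_sum ?L t z)"
        by (rule has_derivative_continuous_on[where
              f' = "\<lambda>x v. time_poly_sum (time_poly_sum_deriv ?L v) (fst x) (snd x)"])
          (use has_derivative_time_poly_sum[OF \<open>open U\<close> hol] K in auto)
      moreover have "compact ({0..1::real} \<times> K)"
        using K by (intro compact_Times) auto
      ultimately have "bounded ((\<lambda>(t, z). time_poly_sum ?L t z) ` ({0..1} \<times> K))"
        using compact_continuous_image compact_imp_bounded by blast
      then show "\<exists>B. \<forall>t\<in>{0..1}. \<forall>z\<in>K. norm ((time_deriv ^^ k) (time_poly_sum L) t z) \<le> B"
        unfolding bounded_iff using eq by fastforce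
    qed
  qed
  with smooth_on_time_poly_sum[OF assms] show ?thesis
    by (simp add: smooth_time_analytic_on_def)
qed

section \<open>Flows\<close>

text \<open>Unfolding smoothness twice: the directional derivatives are themselves smooth, hence
  differentiable, hence continuous.\<close>

lemma smooth_on_derivative:
  fixes f :: "'a::euclidean_space \<Rightarrow> 'b::real_normed_vector"
  assumes "smooth_on A f"
  obtains f' where "\<And>x. x \<in> A \<Longrightarrow> (f has_derivative f' x) (at x within A)"
    and "\<And>v. continuous_on A (\<lambda>x. f' x v)"
proof -
  have cont: "continuous_on A g" if "smooth_on A g" for g :: "'a \<Rightarrow> 'b"
    using that by (cases rule: smooth_on.cases) (auto intro: has_derivative_continuous_on)
  from assms show ?thesis
    by (cases rule: smooth_on.cases) (auto intro: that cont)
qed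

lemma smooth_on_imp_continuous_on:
  fixes f :: "'a::euclidean_space \<Rightarrow> 'b::real_normed_vector"
  assumes "smooth_on A f"
  shows "continuous_on A f"
  using assms by (rule smooth_on_derivative) (auto intro: has_derivative_continuous_on)

lemma has_derivative_time_slice:
  assumes "\<And>p. p \<in> T \<times> U \<Longrightarrow> ((\<lambda>(t, x). u t x) has_derivative u' p) (at p within T \<times> U)"
    and "open U" and "t \<in> T" and "x \<in> U"
  shows "(u t has_derivative (\<lambda>w. u' (t, x) (0, w))) (at x)"
proof -
  have "((\<lambda>x. (\<lambda>(t, x). u t x) (t, x)) has_derivative (\<lambda>w. u' (t, x) (0, w))) (at x within U)"
    using assms by (intro has_derivative_in_compose2[OF assms(1)]) (auto intro!: derivative_eq_intros)
  then show ?thesis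
    using at_within_open[OF assms(4,2)] by simp
qed

text \<open>A bounded derivative gives a Lipschitz bound only on convex sets. Compact support allows
  \<open>X t\<close> to be extended by zero to a differentiable field on the whole plane, where the
  mean value inequality applies.\<close>

lemma smooth_time_cpt_on_lipschitz:
  fixes X :: "real \<Rightarrow> complex \<Rightarrow> complex"
  assumes "open \<Omega>" and "smooth_time_cpt_on \<Omega> X"
  obtains L where "L \<ge> 0"
    and "\<And>t x y. t \<in> {0..1} \<Longrightarrow> x \<in> \<Omega> \<Longrightarrow> y \<in> \<Omega> \<Longrightarrow> norm (X t x - X t y) \<le> L * norm (x - y)"
proof -
  obtain K where smooth: "smooth_on ({0..1} \<times> \<Omega>) (\<lambda>(t, x). X t x)"
    and K: "compact K" "K \<subseteq> {0<..<1} \<times> \<Omega>"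
    and zero: "\<And>t x. t \<in> {0..1} \<Longrightarrow> x \<in> \<Omega> \<Longrightarrow> (t, x) \<notin> K \<Longrightarrow> X t x = 0"
    using assms(2) unfolding smooth_time_cpt_on_def by blast
  obtain X' where X': "\<And>p. p \<in> {0..1} \<times> \<Omega> \<Longrightarrow>
      ((\<lambda>(t, x). X t x) has_derivative X' p) (at p within {0..1} \<times> \<Omega>)"
    and cont: "\<And>v. continuous_on ({0..1} \<times> \<Omega>) (\<lambda>p. X' p v)"
    using smooth_on_derivative[OF smooth] by blast
  define C where "C = snd ` K"
  have "compact C" and "C \<subseteq> \<Omega>"
    using K unfolding C_def by (auto intro!: compact_continuous_image continuous_intros)
  have bounded: "\<exists>B. \<forall>p\<in>{0..1} \<times> C. norm (X' p v) \<le> B" for v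
  proof -
    have "compact ((\<lambda>p. X' p v) ` ({0..1} \<times> C))"
      using cont[of v] \<open>C \<subseteq> \<Omega>\<close> \<open>compact C\<close>
      by (intro compact_continuous_image compact_Times) (auto elim: continuous_on_subset)
    then show ?thesis
      using compact_imp_bounded bounded_iff by (metis imageI)
  qed
  obtain B1 where B1: "\<And>p. p \<in> {0..1} \<times> C \<Longrightarrow> norm (X' p (0, 1)) \<le> B1"
    using bounded by blast
  obtain B2 where B2: "\<And>p. p \<in> {0..1} \<times> C \<Longrightarrow> norm (X' p (0, \<i>)) \<le> B2"
    using bounded by blast
  \<comment> \<open>If \<open>C\<close> is empty, \<open>B1\<close> and \<open>B2\<close> may be
    negative.\<close>
  define L where "L = max B1 0 + max B2 0"
  have "norm (X t x - X t y) \<le> L * norm (x - y)"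
    if t: "t \<in> {0..1}" and xy: "x \<in> \<Omega>" "y \<in> \<Omega>" for t x y
  proof -
    define Y where "Y z = (if z \<in> \<Omega> then X t z else 0)" for z
    define Y' where "Y' z = (if z \<in> C then (\<lambda>w. X' (t, z) (0, w)) else (\<lambda>w. 0))" for z
    have deriv: "(Y has_derivative Y' z) (at z)" for z
    proof (cases "z \<in> C")
      case True
      then have "(X t has_derivative (\<lambda>w. X' (t, z) (0, w))) (at z)"
        using has_derivative_time_slice[OF X' \<open>open \<Omega>\<close> t] \<open>C \<subseteq> \<Omega>\<close> by auto
      then have "(Y has_derivative (\<lambda>w. X' (t, z) (0, w))) (at z)"
        by (rule has_derivative_transform_within_open[OF _ \<open>open \<Omega>\<close>])
          (use True \<open>C \<subseteq> \<Omega>\<close> in \<open>auto simp: Y_def\<close>)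
      with True show ?thesis
        by (simp add: Y'_def)
    next
      case False
      have "0 = Y v" if "v \<in> - C" for v
        using that zero[OF t, of v] by (force simp: Y_def C_def)
      then have "(Y has_derivative (\<lambda>w. 0)) (at z)"
        using False compact_imp_closed[OF \<open>compact C\<close>]
        by (intro has_derivative_transform_within_open[of "\<lambda>v. 0" "\<lambda>w. 0" z UNIV "- C" Y]) auto
      with False show ?thesis
        by (simp add: Y'_def)
    qed
    have "onorm (Y' z) \<le> L" for z
    proof (rule onorm_bound)
      show "norm (Y' z w) \<le> L * norm w" for w
      proof (cases "z \<in> C")
        case True
        interpret linear "Y' z"
          using deriv has_derivative_linear by blast
        have "Y' z w = Re w *\<^sub>R Y' z 1 + Im w *\<^sub>R Y' z \<i>"
        proof -
          have "w = Re w *\<^sub>R 1 + Im w *\<^sub>R \<i>"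
            by (simp add: complex_eq_iff)
          then show ?thesis
            by (metis add scaleR)
        qed
        then have "norm (Y' z w) \<le> \<bar>Re w\<bar> * norm (Y' z 1) + \<bar>Im w\<bar> * norm (Y' z \<i>)"
          by (metis norm_scaleR norm_triangle_ineq)
        also have "\<dots> \<le> norm w * max B1 0 + norm w * max B2 0"
          using True t B1[of "(t, z)"] B2[of "(t, z)"]
          by (intro add_mono mult_mono abs_Re_le_cmod abs_Im_le_cmod) (auto simp: Y'_def)
        finally show ?thesis
          by (simp add: L_def algebra_simps)
      qed (auto simp: Y'_def L_def)
    qed (auto simp: L_def)
    then have "norm (Y x - Y y) \<le> L * norm (x - y)"
      using deriv by (intro differentiable_bound[of UNIV Y Y']) auto
    then show ?thesis
      using xy by (simp add: Y_def)
  qed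
  then show ?thesis
    using that[of L] by (auto simp: L_def)
qed

text \<open>Gronwall's inequality forwards and backwards in time. The squared norm is used because
  it is differentiable also where \<open>d\<close> vanishes.\<close>

lemma exp_growth_bound:
  fixes d :: "real \<Rightarrow> 'a::real_inner"
  assumes d: "\<And>\<tau>. \<tau> \<in> {0..1} \<Longrightarrow> (d has_vector_derivative d' \<tau>) (at \<tau> within {0..1})"
    and le: "\<And>\<tau>. \<tau> \<in> {0..1} \<Longrightarrow> norm (d' \<tau>) \<le> L * norm (d \<tau>)" and t: "t \<in> {0..1}"
  shows "norm (d t) \<le> exp (L * t) * norm (d 0)" and "norm (d 0) \<le> exp (L * t) * norm (d t)"
proof -
  \<comment> \<open>The mean value theorem for
    \<open>exp (c * \<tau>) * (norm (d \<tau>))\<^sup>2\<close>. The derivative is nonpositive for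
    \<open>c = - 2 * L\<close> and nonnegative for \<open>c = 2 * L\<close>.\<close>
  have *: "\<exists>\<tau>\<in>{0..t}. exp (c * t) * (norm (d t))\<^sup>2 - (norm (d 0))\<^sup>2 =
      t * (exp (c * \<tau>) * (c * (norm (d \<tau>))\<^sup>2 + 2 * (d \<tau> \<bullet> d' \<tau>)))" for c
  proof -
    have "((\<lambda>\<tau>. exp (c * \<tau>) * (d \<tau> \<bullet> d \<tau>)) has_derivative
        (\<lambda>h. h * (exp (c * \<tau>) * (c * (d \<tau> \<bullet> d \<tau>) + 2 * (d \<tau> \<bullet> d' \<tau>))))) (at \<tau> within {0..t})"
      if "0 \<le> \<tau>" "\<tau> \<le> t" for \<tau>
    proof -
      have "(d has_derivative (\<lambda>h. h *\<^sub>R d' \<tau>)) (at \<tau> within {0..t})"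
        using d[of \<tau>] that t unfolding has_vector_derivative_def
        by (auto elim!: has_derivative_subset)
      then show ?thesis
        by (auto intro!: derivative_eq_intros simp: inner_commute algebra_simps)
    qed
    from mvt_very_simple[OF _ this] t show ?thesis
      by (auto simp: power2_norm_eq_inner)
  qed
  have inner: "\<bar>d \<tau> \<bullet> d' \<tau>\<bar> \<le> L * (norm (d \<tau>))\<^sup>2" if "\<tau> \<in> {0..t}" for \<tau>
  proof -
    have "\<bar>d \<tau> \<bullet> d' \<tau>\<bar> \<le> norm (d \<tau>) * norm (d' \<tau>)"
      by (rule Cauchy_Schwarz_ineq2)
    also have "\<dots> \<le> norm (d \<tau>) * (L * norm (d \<tau>))"
      using that t by (intro mult_left_mono le) auto
    finally show ?thesis
      by (simp add: power2_eq_square mult_ac)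
  qed
  obtain \<tau> where \<tau>: "\<tau> \<in> {0..t}" "exp (- 2 * L * t) * (norm (d t))\<^sup>2 - (norm (d 0))\<^sup>2 =
      t * (exp (- 2 * L * \<tau>) * (- 2 * L * (norm (d \<tau>))\<^sup>2 + 2 * (d \<tau> \<bullet> d' \<tau>)))"
    using *[of "- 2 * L"] by blast
  have "t * (exp (- 2 * L * \<tau>) * (- 2 * L * (norm (d \<tau>))\<^sup>2 + 2 * (d \<tau> \<bullet> d' \<tau>))) \<le> 0"
    using inner[OF \<tau>(1)] t by (intro mult_nonneg_nonpos) (auto simp: algebra_simps)
  then have "exp (- 2 * L * t) * (norm (d t))\<^sup>2 \<le> (norm (d 0))\<^sup>2"
    using \<tau>(2) by linarith
  then have "(exp (L * t))\<^sup>2 * (exp (- 2 * L * t) * (norm (d t))\<^sup>2) \<le> (exp (L * t))\<^sup>2 * (norm (d 0))\<^sup>2"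
    by (intro mult_left_mono) auto
  moreover have "(exp (L * t))\<^sup>2 * exp (- 2 * L * t) = 1"
    by (simp add: power2_eq_square flip: exp_add)
  then have "(exp (L * t))\<^sup>2 * (exp (- 2 * L * t) * (norm (d t))\<^sup>2) = (norm (d t))\<^sup>2"
    by (simp only: mult.assoc[symmetric] mult_1)
  ultimately have "(norm (d t))\<^sup>2 \<le> (exp (L * t) * norm (d 0))\<^sup>2"
    by (simp only: power_mult_distrib)
  then show "norm (d t) \<le> exp (L * t) * norm (d 0)"
    by (rule power2_le_imp_le) simp
  obtain \<tau> where \<tau>: "\<tau> \<in> {0..t}" "exp (2 * L * t) * (norm (d t))\<^sup>2 - (norm (d 0))\<^sup>2 =
      t * (exp (2 * L * \<tau>) * (2 * L * (norm (d \<tau>))\<^sup>2 + 2 * (d \<tau> \<bullet> d' \<tau>)))"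
    using *[of "2 * L"] by blast
  have "0 \<le> t * (exp (2 * L * \<tau>) * (2 * L * (norm (d \<tau>))\<^sup>2 + 2 * (d \<tau> \<bullet> d' \<tau>)))"
    using inner[OF \<tau>(1)] t by (intro mult_nonneg_nonneg) (auto simp: abs_le_iff)
  then have "(norm (d 0))\<^sup>2 \<le> exp (2 * L * t) * (norm (d t))\<^sup>2"
    using \<tau>(2) by linarith
  also have "\<dots> = (exp (L * t) * norm (d t))\<^sup>2"
    by (simp add: power_mult_distrib mult.assoc flip: exp_double)
  finally show "norm (d 0) \<le> exp (L * t) * norm (d t)"
    by (rule power2_le_imp_le) simp
qed

text \<open>The growth bounds for the difference of two trajectories. The upper estimate yields
  continuity in the initial point, the lower one injectivity.\<close>

lemma is_flow_bilipschitz: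
  assumes "is_flow \<Omega> X F"
    and L: "\<And>t x y. t \<in> {0..1} \<Longrightarrow> x \<in> \<Omega> \<Longrightarrow> y \<in> \<Omega> \<Longrightarrow> norm (X t x - X t y) \<le> L * norm (x - y)"
    and "x \<in> \<Omega>" "y \<in> \<Omega>" and t: "t \<in> {0..1}"
  shows "norm (F 0 t x - F 0 t y) \<le> exp (L * t) * norm (x - y)"
    and "norm (x - y) \<le> exp (L * t) * norm (F 0 t x - F 0 t y)"
proof -
  have F: "F 0 0 z = z" "\<And>\<tau>. \<tau> \<in> {0..1} \<Longrightarrow> F 0 \<tau> z \<in> \<Omega>"
    "\<And>\<tau>. \<tau> \<in> {0..1} \<Longrightarrow> ((\<lambda>\<tau>. F 0 \<tau> z) has_vector_derivative X \<tau> (F 0 \<tau> z)) (at \<tau> within {0..1})"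
    if "z \<in> \<Omega>" for z
    using assms(1) that unfolding is_flow_def by (metis atLeastAtMost_iff order_refl zero_le_one)+
  have d: "((\<lambda>\<tau>. F 0 \<tau> x - F 0 \<tau> y) has_vector_derivative X \<tau> (F 0 \<tau> x) - X \<tau> (F 0 \<tau> y))
      (at \<tau> within {0..1})" if "\<tau> \<in> {0..1}" for \<tau>
    using that assms(3,4) by (intro has_vector_derivative_diff F)
  have le: "norm (X \<tau> (F 0 \<tau> x) - X \<tau> (F 0 \<tau> y)) \<le> L * norm (F 0 \<tau> x - F 0 \<tau> y)"
    if "\<tau> \<in> {0..1}" for \<tau>
    using that assms(3,4) by (intro L F)
  from exp_growth_bound[OF d le t] F(1)[OF assms(3)] F(1)[OF assms(4)]
  show "norm (F 0 t x - F 0 t y) \<le> exp (L * t) * norm (x - y)"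
    and "norm (x - y) \<le> exp (L * t) * norm (F 0 t x - F 0 t y)"
    by simp_all
qed

text \<open>Trajectories are continuous in time, and the Lipschitz constant \<open>exp L\<close> in
  space is the same for all times; together this is joint continuity.\<close>

lemma is_flow_continuous_on:
  assumes "is_flow \<Omega> X F" and "L \<ge> 0"
    and L: "\<And>t x y. t \<in> {0..1} \<Longrightarrow> x \<in> \<Omega> \<Longrightarrow> y \<in> \<Omega> \<Longrightarrow> norm (X t x - X t y) \<le> L * norm (x - y)"
  shows "continuous_on ({0..1} \<times> \<Omega>) (\<lambda>(t, x). F 0 t x)"
proof (rule continuous_on_TimesI)
  have "(exp L)-lipschitz_on \<Omega> (F 0 t)" if "t \<in> {0..1}" for t
  proof (rule lipschitz_onI)
    fix x y assume "x \<in> \<Omega>" "y \<in> \<Omega>"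
    then have "norm (F 0 t x - F 0 t y) \<le> exp (L * t) * norm (x - y)"
      using is_flow_bilipschitz(1)[OF assms(1) L] that by blast
    also have "\<dots> \<le> exp L * norm (x - y)"
      using \<open>L \<ge> 0\<close> that by (intro mult_right_mono) (auto simp: mult_left_le)
    finally show "dist (F 0 t x) (F 0 t y) \<le> exp L * dist x y"
      by (simp add: dist_norm)
  qed simp
  then show "local_lipschitz {0..1} \<Omega> (F 0)"
    unfolding local_lipschitz_def
    by (intro ballI exI[of _ "1::real"] conjI exI[of _ "exp L"]) (auto intro: lipschitz_on_subset)
  show "continuous_on {0..1} (\<lambda>t. F 0 t x)" if "x \<in> \<Omega>" for x
    using assms(1) that unfolding is_flow_def
    by (intro continuous_on_vector_derivative[of _ _ "\<lambda>t. X t (F 0 t x)"]) auto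
qed

text \<open>The winding numbers of \<open>\<gamma>\<close> about points outside \<open>U\<close> vanish and are preserved by the flow.\<close>

lemma inside_flow_image_subset:
  assumes flow: "is_flow \<Omega> X F" and "L \<ge> 0"
    and L: "\<And>t x y. t \<in> {0..1} \<Longrightarrow> x \<in> \<Omega> \<Longrightarrow> y \<in> \<Omega> \<Longrightarrow> norm (X t x - X t y) \<le> L * norm (x - y)"
    and \<gamma>: "jordan_curve \<gamma>" and "path_image \<gamma> \<subseteq> \<Omega>"
    and U: "\<And>t. t \<in> {0..1} \<Longrightarrow> F 0 t ` path_image \<gamma> \<subseteq> U"
    and wind: "\<And>z. z \<notin> U \<Longrightarrow> winding_number \<gamma> z = 0"
    and t: "t \<in> {0..1}"
  shows "inside (F 0 t ` path_image \<gamma>) \<subseteq> U"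
proof
  have "simple_path \<gamma>" and loop: "pathfinish \<gamma> = pathstart \<gamma>"
    using \<gamma> by (auto simp: jordan_curve_def)
  then have "path \<gamma>"
    by (simp add: simple_path_imp_path)
  have cont: "continuous_on ({0..1} \<times> \<Omega>) (\<lambda>(t, x). F 0 t x)"
    using is_flow_continuous_on[OF flow \<open>L \<ge> 0\<close> L] .
  have mem: "\<gamma> x \<in> \<Omega>" if "x \<in> {0..1}" for x
    using assms(5) that by (auto simp: path_image_def)
  have "inj_on (F 0 t) (path_image \<gamma>)"
  proof (rule inj_onI)
    fix x y assume "x \<in> path_image \<gamma>" "y \<in> path_image \<gamma>" "F 0 t x = F 0 t y"
    then show "x = y"
      using is_flow_bilipschitz(2)[OF flow L, of x y t] assms(5) t by auto
  qed
  moreover have "continuous_on (path_image \<gamma>) (\<lambda>x. (\<lambda>(t, x). F 0 t x) (t, x))"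
    by (rule continuous_on_compose2[OF cont]) (use t assms(5) in \<open>auto intro!: continuous_intros\<close>)
  \<comment> \<open>Simplicity makes the winding number about any inside point have norm 1, which
    will contradict the value 0 carried along by the homotopy.\<close>
  ultimately have simple: "simple_path (F 0 t \<circ> \<gamma>)"
    using \<open>simple_path \<gamma>\<close> by (intro simple_path_continuous_image) auto
  have hom: "homotopic_loops U \<gamma> (F 0 t \<circ> \<gamma>)"
    unfolding homotopic_loops
  proof (intro exI[of _ "\<lambda>(s, x). F 0 (s * t) (\<gamma> x)"] conjI ballI)
    have "continuous_on ({0..1} \<times> {0..1}) (\<lambda>p. \<gamma> (snd p))"
      by (rule continuous_on_compose2[OF \<open>path \<gamma>\<close>[unfolded path_def]]) (auto intro!: continuous_intros)
    then have "continuous_on ({0..1} \<times> {0..1}) (\<lambda>p. (\<lambda>(t, x). F 0 t x) (fst p * t, \<gamma> (snd p)))"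
      using t mem
      by (intro continuous_on_compose2[OF cont] continuous_intros) (auto simp: mult_le_one)
    then show "continuous_on ({0..1} \<times> {0..1}) (\<lambda>(s, x). F 0 (s * t) (\<gamma> x))"
      by (simp add: case_prod_unfold)
    show "(\<lambda>(s, x). F 0 (s * t) (\<gamma> x)) \<in> {0..1} \<times> {0..1} \<rightarrow> U"
    proof
      fix p :: "real \<times> real" assume p: "p \<in> {0..1} \<times> {0..1}"
      then have "fst p * t \<in> {0..1}" "\<gamma> (snd p) \<in> path_image \<gamma>"
        using t by (auto simp: mult_le_one path_image_def)
      then show "(case p of (s, x) \<Rightarrow> F 0 (s * t) (\<gamma> x)) \<in> U"
        using U by (auto simp: case_prod_unfold)
    qed
    show "(case (0, x) of (s, x) \<Rightarrow> F 0 (s * t) (\<gamma> x)) = \<gamma> x" if "x \<in> {0..1}" for x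
      using flow mem[OF that] unfolding is_flow_def by auto
  qed (use loop in \<open>auto simp: pathfinish_def pathstart_def\<close>)
  fix z assume z: "z \<in> inside (F 0 t ` path_image \<gamma>)"
  show "z \<in> U"
  proof (rule ccontr)
    assume "z \<notin> U"
    then have "homotopic_loops (- {z}) \<gamma> (F 0 t \<circ> \<gamma>)"
      using hom by (auto elim: homotopic_loops_subset)
    then have "winding_number (F 0 t \<circ> \<gamma>) z = 0"
      using winding_number_homotopic_loops wind[OF \<open>z \<notin> U\<close>] by metis
    moreover have "norm (winding_number (F 0 t \<circ> \<gamma>) z) = 1"
      using z by (intro simple_closed_path_norm_winding_number_inside simple)
        (simp add: path_image_compose)
    ultimately show False
      by simp
  qed
qed

section \<open>Gradients of harmonic functions\<close>

text \<open>The mean value theorem in direction \<open>a\<close> reduces the second difference to a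
  difference of values of \<open>Y\<close>, which the linearisation of \<open>Y\<close> at
  \<open>x\<close> evaluates. The two points lie within \<open>2 * h\<close> and \<open>h\<close> of
  \<open>x\<close>, whence the factor 3.\<close>

lemma second_difference_gradient:
  fixes \<phi> :: "'a::real_inner \<Rightarrow> real"
  assumes grad: "\<And>y. norm (y - x) < \<delta> \<Longrightarrow> GDERIV \<phi> y :> Y y"
    and D: "linear D" and err: "\<And>y. norm (y - x) < \<delta> \<Longrightarrow> norm (Y y - Y x - D (y - x)) \<le> \<epsilon> * norm (y - x)"
    and h: "0 < h" "2 * h < \<delta>" and unit: "norm a = 1" "norm b = 1" and "\<epsilon> \<ge> 0"
  shows "\<bar>\<phi> (x + h *\<^sub>R a + h *\<^sub>R b) - \<phi> (x + h *\<^sub>R a) - \<phi> (x + h *\<^sub>R b) + \<phi> x - h\<^sup>2 * (a \<bullet> D b)\<bar>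
    \<le> 3 * \<epsilon> * h\<^sup>2"
proof -
  define u where "u s = \<phi> (x + s *\<^sub>R a + h *\<^sub>R b) - \<phi> (x + s *\<^sub>R a)" for s
  define u' where "u' s = a \<bullet> Y (x + s *\<^sub>R a + h *\<^sub>R b) - a \<bullet> Y (x + s *\<^sub>R a)" for s
  have near: "norm (x + s *\<^sub>R a + h *\<^sub>R b - x) \<le> 2 * h" "norm (x + s *\<^sub>R a - x) \<le> h"
    "norm (x + s *\<^sub>R a + h *\<^sub>R b - x) < \<delta>" "norm (x + s *\<^sub>R a - x) < \<delta>"
    if "0 \<le> s" "s \<le> h" for s
  proof -
    have "norm (s *\<^sub>R a) \<le> h" "norm (h *\<^sub>R b) = h"
      using that h unit by simp_all
    moreover from this have "norm (s *\<^sub>R a + h *\<^sub>R b) \<le> 2 * h"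
      using norm_triangle_ineq[of "s *\<^sub>R a" "h *\<^sub>R b"] by linarith
    moreover have "x + s *\<^sub>R a + h *\<^sub>R b - x = s *\<^sub>R a + h *\<^sub>R b" "x + s *\<^sub>R a - x = s *\<^sub>R a"
      by simp_all
    ultimately show "norm (x + s *\<^sub>R a + h *\<^sub>R b - x) \<le> 2 * h" "norm (x + s *\<^sub>R a - x) \<le> h"
      "norm (x + s *\<^sub>R a + h *\<^sub>R b - x) < \<delta>" "norm (x + s *\<^sub>R a - x) < \<delta>"
      using h by simp_all
  qed
  have "(u has_real_derivative u' s) (at s)" if "0 \<le> s" "s \<le> h" for s
  proof -
    have *: "((\<lambda>s. \<phi> (x + s *\<^sub>R a + v)) has_real_derivative a \<bullet> Y (x + s *\<^sub>R a + v)) (at s)"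
      if "norm (x + s *\<^sub>R a + v - x) < \<delta>" for v
    proof -
      have "((\<lambda>s. x + s *\<^sub>R a + v) has_derivative (\<lambda>r. r *\<^sub>R a)) (at s)"
        by (auto intro!: derivative_eq_intros)
      from has_derivative_compose[OF this grad[OF that, unfolded gderiv_def]] show ?thesis
        unfolding has_field_derivative_def by (simp add: mult_commute_abs)
    qed
    from *[of "h *\<^sub>R b"] *[of 0] near[OF that] show ?thesis
      unfolding u_def u'_def by (intro DERIV_diff) simp_all
  qed
  then obtain s where s: "0 < s" "s < h" "u h - u 0 = (h - 0) * u' s"
    using MVT2[of 0 h u u'] h by blast
  let ?y1 = "x + s *\<^sub>R a + h *\<^sub>R b" and ?y2 = "x + s *\<^sub>R a"
  define e where "e = (Y ?y1 - Y x - D (?y1 - x)) - (Y ?y2 - Y x - D (?y2 - x))"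
  have s': "0 \<le> s" "s \<le> h"
    using s by simp_all
  have "norm (Y ?y1 - Y x - D (?y1 - x)) \<le> \<epsilon> * (2 * h)"
    by (rule order.trans[OF err[OF near(3)[OF s']] mult_left_mono[OF near(1)[OF s'] \<open>\<epsilon> \<ge> 0\<close>]])
  moreover have "norm (Y ?y2 - Y x - D (?y2 - x)) \<le> \<epsilon> * h"
    by (rule order.trans[OF err[OF near(4)[OF s']] mult_left_mono[OF near(2)[OF s'] \<open>\<epsilon> \<ge> 0\<close>]])
  ultimately have "norm e \<le> 3 * \<epsilon> * h"
    unfolding e_def using norm_triangle_ineq4[of "Y ?y1 - Y x - D (?y1 - x)" "Y ?y2 - Y x - D (?y2 - x)"]
    by simp
  then have "\<bar>a \<bullet> e\<bar> \<le> 3 * \<epsilon> * h"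
    using Cauchy_Schwarz_ineq2[of a e] unit by simp
  moreover have "u' s = h * (a \<bullet> D b) + a \<bullet> e"
  proof -
    have "D (?y1 - x) - D (?y2 - x) = h *\<^sub>R D b"
      using linear_diff[OF D, of "?y1 - x" "?y2 - x"] linear_scale[OF D, of h b] by simp
    then have "Y ?y1 - Y ?y2 = h *\<^sub>R D b + e"
      by (simp add: e_def algebra_simps)
    then show ?thesis
      unfolding u'_def by (metis inner_add_right inner_diff_right inner_scaleR_right)
  qed
  then have "h * u' s - h\<^sup>2 * (a \<bullet> D b) = h * (a \<bullet> e)"
    by (simp add: power2_eq_square distrib_left)
  ultimately have "\<bar>h * u' s - h\<^sup>2 * (a \<bullet> D b)\<bar> \<le> h * (3 * \<epsilon> * h)"
    using h by (simp add: abs_mult mult_left_mono)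
  also have "h * u' s = \<phi> (x + h *\<^sub>R a + h *\<^sub>R b) - \<phi> (x + h *\<^sub>R a) - \<phi> (x + h *\<^sub>R b) + \<phi> x"
    using s(3) by (simp add: u_def)
  also have "h * (3 * \<epsilon> * h) = 3 * \<epsilon> * h\<^sup>2"
    by (simp add: power2_eq_square)
  finally show ?thesis .
qed

text \<open>Schwarz's theorem: the second difference is symmetric in \<open>a\<close> and
  \<open>b\<close>, and divided by \<open>h\<^sup>2\<close> it approximates both sides.\<close>

lemma gradient_derivative_symmetric:
  fixes \<phi> :: "'a::real_inner \<Rightarrow> real"
  assumes "open U" and "x \<in> U" and grad: "\<And>y. y \<in> U \<Longrightarrow> GDERIV \<phi> y :> Y y"
    and D: "(Y has_derivative D) (at x)" and unit: "norm a = 1" "norm b = 1"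
  shows "a \<bullet> D b = b \<bullet> D a"
proof -
  have "\<bar>a \<bullet> D b - b \<bullet> D a\<bar> \<le> e" if "e > 0" for e
  proof -
    \<comment> \<open>Two second difference estimates are added, each with error
      \<open>3 * \<epsilon> * h\<^sup>2\<close>.\<close>
    define \<epsilon> where "\<epsilon> = e / 6"
    have "\<epsilon> > 0"
      using that by (simp add: \<epsilon>_def)
    obtain \<delta>1 where "\<delta>1 > 0" and \<delta>1: "\<And>y. norm (y - x) < \<delta>1 \<Longrightarrow>
        norm (Y y - Y x - D (y - x)) \<le> \<epsilon> * norm (y - x)"
      using D \<open>\<epsilon> > 0\<close> unfolding has_derivative_at_alt by blast
    obtain \<delta>2 where "\<delta>2 > 0" and \<delta>2: "ball x \<delta>2 \<subseteq> U"
      using \<open>open U\<close> \<open>x \<in> U\<close> open_contains_ball by blast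
    define \<delta> where "\<delta> = min \<delta>1 \<delta>2"
    define h where "h = \<delta> / 3"
    have h: "0 < h" "2 * h < \<delta>"
      using \<open>\<delta>1 > 0\<close> \<open>\<delta>2 > 0\<close> by (auto simp: h_def \<delta>_def)
    have grad': "GDERIV \<phi> y :> Y y" if "norm (y - x) < \<delta>" for y
      using that \<delta>2 by (intro grad) (auto simp: \<delta>_def dist_norm norm_minus_commute subset_eq)
    have err: "norm (Y y - Y x - D (y - x)) \<le> \<epsilon> * norm (y - x)" if "norm (y - x) < \<delta>" for y
      using \<delta>1 that by (simp add: \<delta>_def)
    have bound: "\<bar>\<phi> (x + h *\<^sub>R a + h *\<^sub>R b) - \<phi> (x + h *\<^sub>R a) - \<phi> (x + h *\<^sub>R b) + \<phi> x
        - h\<^sup>2 * (a \<bullet> D b)\<bar> \<le> 3 * \<epsilon> * h\<^sup>2" if "norm a = 1" "norm b = 1" for a b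
      by (rule second_difference_gradient[OF grad' has_derivative_linear[OF D] err h that
            less_imp_le[OF \<open>\<epsilon> > 0\<close>]])
    have "\<bar>h\<^sup>2 * (a \<bullet> D b) - h\<^sup>2 * (b \<bullet> D a)\<bar> \<le> h\<^sup>2 * e"
    proof -
      have comm: "x + h *\<^sub>R b + h *\<^sub>R a = x + h *\<^sub>R a + h *\<^sub>R b"
        by simp
      have "3 * \<epsilon> * h\<^sup>2 = h\<^sup>2 * e / 2"
        by (simp add: \<epsilon>_def)
      with bound[OF unit] bound[OF unit(2,1), unfolded comm] show ?thesis
        by linarith
    qed
    then have "h\<^sup>2 * \<bar>a \<bullet> D b - b \<bullet> D a\<bar> \<le> h\<^sup>2 * e"
      by (simp add: abs_mult flip: right_diff_distrib)
    then show ?thesis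
      using h by simp
  qed
  then have "\<bar>a \<bullet> D b - b \<bullet> D a\<bar> \<le> 0"
    by (rule field_le_epsilon) simp
  then show ?thesis
    by simp
qed

text \<open>A symmetric real 2 by 2 matrix of trace 0, followed by conjugation, is multiplication by
  a complex number.\<close>

lemma holomorphic_on_cnj_gradient:
  fixes \<phi> :: "complex \<Rightarrow> real"
  assumes "open U" and grad: "\<And>z. z \<in> U \<Longrightarrow> GDERIV \<phi> z :> Y z"
    and diff: "\<And>z. z \<in> U \<Longrightarrow> Y differentiable at z"
    and div: "\<And>z. z \<in> U \<Longrightarrow> divergence Y z = 0"
  shows "(\<lambda>z. cnj (Y z)) holomorphic_on U"
proof -
  have "((\<lambda>z. cnj (Y z)) has_field_derivative cnj (frechet_derivative Y (at z) 1)) (at z)"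
    if z: "z \<in> U" for z
  proof -
    define D where "D = frechet_derivative Y (at z)"
    have D: "(Y has_derivative D) (at z)"
      using diff[OF z] unfolding D_def frechet_derivative_works .
    have "Im (D 1) = Re (D \<i>)"
      using gradient_derivative_symmetric[OF \<open>open U\<close> z grad D, of \<i> 1] by (simp add: inner_complex_def)
    moreover have "Re (D 1) + Im (D \<i>) = 0"
      using div[OF z] by (simp add: divergence_def D_def)
    ultimately have Di: "cnj (D \<i>) = \<i> * cnj (D 1)"
      by (simp add: complex_eq_iff)
    have eq: "cnj (D w) = cnj (D 1) * w" for w
    proof -
      have "w = Re w *\<^sub>R 1 + Im w *\<^sub>R \<i>"
        by (simp add: complex_eq_iff)
      then have "D w = Re w *\<^sub>R D 1 + Im w *\<^sub>R D \<i>"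
        using has_derivative_linear[OF D] by (metis linear_add linear_scale)
      then have "cnj (D w) = of_real (Re w) * cnj (D 1) + of_real (Im w) * cnj (D \<i>)"
        by (simp add: scaleR_conv_of_real)
      also have "\<dots> = cnj (D 1) * (of_real (Re w) + \<i> * of_real (Im w))"
        unfolding Di by (simp add: algebra_simps)
      finally show ?thesis
        by (simp flip: complex_eq)
    qed
    have "(\<lambda>w. cnj (D w)) = (*) (cnj (D 1))"
      by (rule ext) (rule eq)
    with has_derivative_cnj[OF D] show ?thesis
      unfolding has_field_derivative_def D_def by simp
  qed
  then show ?thesis
    by (auto simp: holomorphic_on_open[OF \<open>open U\<close>])
qed

section \<open>Approximation on the swept region\<close>

lemma compact_points_away_from_complement:
  fixes U :: "complex set"
  assumes "open U" and "bounded U" and "r > 0"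
  shows "compact {w. \<forall>z\<in>- U. r \<le> dist z w}" and "{w. \<forall>z\<in>- U. r \<le> dist z w} \<subseteq> U"
proof -
  show "{w. \<forall>z\<in>- U. r \<le> dist z w} \<subseteq> U"
    using \<open>r > 0\<close> by force
  moreover have "closed (\<Inter>z\<in>- U. {w. r \<le> dist z w})"
    by (intro closed_INT ballI closed_Collect_le continuous_intros)
  moreover have "(\<Inter>z\<in>- U. {w. r \<le> dist z w}) = {w. \<forall>z\<in>- U. r \<le> dist z w}"
    by auto
  ultimately show "compact {w. \<forall>z\<in>- U. r \<le> dist z w}"
    using \<open>bounded U\<close> bounded_subset compact_eq_bounded_closed by metis
qed

text \<open>If \<open>w\<close> were closer than \<open>r\<close> to some \<open>z\<close> outside
  \<open>U\<close>, the disc about \<open>z\<close> would miss \<open>B\<close> and connect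
  \<open>w\<close> to \<open>z\<close>, so \<open>z\<close> would be inside as well.\<close>

lemma inside_subset_points_away_from_complement:
  fixes U :: "complex set"
  assumes "inside B \<subseteq> U" and B: "(\<Union>x\<in>B. cball x r) \<subseteq> U"
  shows "inside B \<subseteq> {w. \<forall>z\<in>- U. r \<le> dist z w}"
proof (clarify, rule ccontr)
  fix w z assume w: "w \<in> inside B" and z: "z \<notin> U" and "\<not> r \<le> dist z w"
  then have "dist z w < r"
    by simp
  moreover from this have "0 < r"
    using zero_le_dist[of z w] by linarith
  ultimately have "w \<in> ball z r" "z \<in> ball z r"
    by simp_all
  moreover have "ball z r \<subseteq> - B"
  proof
    fix x assume "x \<in> ball z r"
    then have "z \<in> cball x r"
      by (simp add: dist_commute)
    then show "x \<in> - B"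
      using B z by blast
  qed
  ultimately have "connected_component (- B) w z"
    unfolding connected_component_def by (intro exI[of _ "ball z r"]) auto
  with w have "z \<in> inside B"
    using inside_same_component by blast
  with assms(1) z show False
    by blast
qed

text \<open>A disc about a nearby point \<open>z\<close> outside \<open>U\<close> leads from
  \<open>w\<close> to \<open>z\<close>; from there the component of \<open>z\<close> in
  \<open>- U\<close> leads to \<open>S\<close>. Both stay off the compact set.\<close>

lemma connected_component_away_from_complement:
  fixes U :: "complex set"
  assumes S: "\<And>C. C \<in> components (- U) \<Longrightarrow> S \<inter> C \<noteq> {}" and "r > 0"
    and w: "w \<notin> {w. \<forall>z\<in>- U. r \<le> dist z w}"
  shows "\<exists>s\<in>S. connected_component (- {w. \<forall>z\<in>- U. r \<le> dist z w}) w s"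
proof -
  let ?K = "{w. \<forall>z\<in>- U. r \<le> dist z w}"
  obtain z where z: "z \<notin> U" "dist z w < r"
    using w by force
  then have "ball z r \<subseteq> - ?K"
    by force
  then have wz: "connected_component (- ?K) w z"
    unfolding connected_component_def using z \<open>r > 0\<close> by (intro exI[of _ "ball z r"]) auto
  have "connected_component_set (- U) z \<in> components (- U)"
    using z by (auto simp: components_def)
  then obtain s where "s \<in> S" and "connected_component (- U) z s"
    using S by (auto simp: disjoint_iff)
  moreover have "- U \<subseteq> - ?K"
    using \<open>r > 0\<close> by force
  ultimately have "connected_component (- ?K) z s"
    by (blast intro: connected_component_of_subset[of "- U" z s])
  with wz \<open>s \<in> S\<close> show ?thesis
    by (blast intro: connected_component_trans)
qed

text \<open>
  The summand \<open>\<delta> / (z - s)\<^sup>N\<close>, with \<open>N\<close> exceeding all other pole orders, keeps a pole at every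
  \<open>s \<in> S\<close> at all times.
\<close>

lemma rational_approximation_in_time:
  fixes g :: "real \<Rightarrow> complex \<Rightarrow> complex"
  assumes "compact K" and "open U" and "K \<subseteq> U" and "finite S" and "S \<inter> U = {}"
    and S: "\<And>w. w \<notin> K \<Longrightarrow> \<exists>s\<in>S. connected_component (- K) w s"
    and hol: "\<And>t. t \<in> {0..1} \<Longrightarrow> g t holomorphic_on U"
    and cont: "continuous_on ({0..1} \<times> K) (\<lambda>(t, z). g t z)" and "\<epsilon> > 0"
  obtains R where "smooth_time_analytic_on (- S) R"
    and "\<And>t. rational_with_poles_exactly S (R t)" and "\<And>t. R t holomorphic_on - S"
    and "\<And>t z. t \<in> {0..1} \<Longrightarrow> z \<in> K \<Longrightarrow> norm (g t z - R t z) \<le> \<epsilon>"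
proof -
  have "\<epsilon> / 3 > 0"
    using \<open>\<epsilon> > 0\<close> by simp
  obtain n where "n > 0" and n: "\<And>t z. t \<in> {0..1} \<Longrightarrow> z \<in> K \<Longrightarrow>
      norm (g t z - (\<Sum>k\<le>n. Bernstein n k t *\<^sub>R g (real k / real n) z)) \<le> \<epsilon> / 3"
    using Bernstein_approximation[OF \<open>compact K\<close> cont \<open>\<epsilon> / 3 > 0\<close>] by blast
  \<comment> \<open>One third of \<epsilon> each goes to interpolation in time, to Runge at the
    nodes, and to \<open>top\<close>. The Bernstein weights are nonnegative with sum 1, so the
    errors at the nodes do not accumulate.\<close>
  have "\<forall>k\<in>{..n}. \<exists>p. \<forall>z\<in>K. norm (g (real k / real n) z - pole_sum S p z) \<le> \<epsilon> / 3"
  proof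
    fix k assume "k \<in> {..n}"
    then have "g (real k / real n) holomorphic_on U"
      using \<open>n > 0\<close> by (intro hol) auto
    then have "pole_approximable S K (g (real k / real n))"
      using assms(1-4) S by (intro Runge) auto
    then show "\<exists>p. \<forall>z\<in>K. norm (g (real k / real n) z - pole_sum S p z) \<le> \<epsilon> / 3"
      using \<open>\<epsilon> / 3 > 0\<close> unfolding pole_approximable_def by blast
  qed
  then obtain p where p: "\<And>k z. k \<le> n \<Longrightarrow> z \<in> K \<Longrightarrow>
      norm (g (real k / real n) z - pole_sum S (p k) z) \<le> \<epsilon> / 3"
    by (metis atMost_iff)
  have "finite ((\<lambda>(k, s). degree (p k s)) ` ({..n} \<times> S))"
    using \<open>finite S\<close> by simp
  then obtain m where "\<forall>d\<in>(\<lambda>(k, s). degree (p k s)) ` ({..n} \<times> S). d < m"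
    unfolding finite_nat_set_iff_bounded by blast
  then have m: "degree (p k s) < m" if "k \<le> n" "s \<in> S" for k s
    using that by auto
  define N where "N = Suc m"
  have "bounded ((\<lambda>z. \<Sum>s\<in>S. inverse (z - s) ^ N) ` K)"
    using assms(1,3,5) by (intro compact_imp_bounded compact_continuous_image continuous_intros) auto
  then obtain M where "M > 0" and M: "\<And>z. z \<in> K \<Longrightarrow> norm (\<Sum>s\<in>S. inverse (z - s) ^ N) \<le> M"
    unfolding bounded_pos by auto
  define \<delta> where "\<delta> = \<epsilon> / (3 * M)"
  have "\<delta> > 0"
    using \<open>\<epsilon> > 0\<close> \<open>M > 0\<close> by (simp add: \<delta>_def)
  define top where "top = pole_sum S (\<lambda>s. monom (of_real \<delta>) N)"
  define b where "b k = (of_nat (n choose k) * [:0, 1:] ^ k * [:1, - 1:] ^ (n - k) :: real poly)" for k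
  have b: "poly (b k) t = Bernstein n k t" for k t
    by (simp add: b_def Bernstein_def of_nat_poly)
  define L where "L = map (\<lambda>k. (b k, pole_sum S (p k))) [0..<Suc n] @ [(1, top)]"
  define R where "R = time_poly_sum L"
  have R: "R t z = (\<Sum>k\<le>n. of_real (Bernstein n k t) * pole_sum S (p k) z) + top z" for t z
  proof -
    have "R t z = (\<Sum>k\<leftarrow>[0..<Suc n]. of_real (Bernstein n k t) * pole_sum S (p k) z) + top z"
      by (simp add: R_def L_def time_poly_sum_def o_def b)
    also have "(\<Sum>k\<leftarrow>[0..<Suc n]. of_real (Bernstein n k t) * pole_sum S (p k) z) =
        (\<Sum>k\<le>n. of_real (Bernstein n k t) * pole_sum S (p k) z)"
      by (simp only: interv_sum_list_conv_sum_set_nat set_upt atLeast0LessThan lessThan_Suc_atMost)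
    finally show ?thesis .
  qed
  have hol_L: "\<forall>(b, q)\<in>set L. q holomorphic_on - S"
    by (auto simp: L_def top_def intro!: holomorphic_on_pole_sum)
  show ?thesis
  proof (rule that)
    show "smooth_time_analytic_on (- S) R"
      unfolding R_def using hol_L \<open>finite S\<close>
      by (intro smooth_time_analytic_on_time_poly_sum open_Compl finite_imp_closed)
    show "R t holomorphic_on - S" for t
      unfolding R_def using hol_L by (rule holomorphic_on_time_poly_sum)
    show "rational_with_poles_exactly S (R t)" for t
    proof -
      define P where "P s = (\<Sum>k\<le>n. smult (of_real (Bernstein n k t)) (p k s)) + monom (of_real \<delta>) N" for s
      have "R t z = pole_sum S P z" for z
        unfolding R top_def pole_sum_def P_def
        by (simp add: poly_sum sum.distrib sum_distrib_left sum.swap[of _ S])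
      then have "R t = pole_sum S P"
        by (rule ext)
      moreover have "degree (P s) > 0" if "s \<in> S" for s
      proof -
        have "degree (\<Sum>k\<le>n. smult (of_real (Bernstein n k t)) (p k s)) < N"
          using m[OF _ that] by (intro degree_sum_less)
            (auto simp: N_def intro!: le_imp_less_Suc order.trans[OF degree_smult_le] less_imp_le)
        then show ?thesis
          using \<open>\<delta> > 0\<close> by (simp add: P_def degree_add_eq_right degree_monom_eq N_def)
      qed
      ultimately show ?thesis
        using rational_with_poles_exactly_pole_sum[OF \<open>finite S\<close>, of P] by simp
    qed
    fix t z assume t: "t \<in> {0..1::real}" and z: "z \<in> K"
    have "norm ((\<Sum>k\<le>n. Bernstein n k t *\<^sub>R g (real k / real n) z) -
        (\<Sum>k\<le>n. of_real (Bernstein n k t) * pole_sum S (p k) z)) \<le>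
        (\<Sum>k\<le>n. Bernstein n k t * (\<epsilon> / 3))"
      unfolding sum_subtractf[symmetric] scaleR_conv_of_real right_diff_distrib[symmetric]
      using t z p
      by (auto intro!: order.trans[OF norm_sum] sum_mono mult_left_mono
          simp: norm_mult Bernstein_nonneg simp del: times_divide_eq_right)
    also have "\<dots> = \<epsilon> / 3"
      by (simp only: sum_Bernstein mult_1 flip: sum_distrib_right)
    finally have "norm ((\<Sum>k\<le>n. Bernstein n k t *\<^sub>R g (real k / real n) z) -
        (\<Sum>k\<le>n. of_real (Bernstein n k t) * pole_sum S (p k) z)) \<le> \<epsilon> / 3" .
    moreover have "norm (top z) \<le> \<epsilon> / 3"
    proof -
      have "top z = of_real \<delta> * (\<Sum>s\<in>S. inverse (z - s) ^ N)"
        by (simp add: top_def pole_sum_def poly_monom sum_distrib_left)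
      then have "norm (top z) \<le> \<delta> * M"
        using M[OF z] \<open>\<delta> > 0\<close> by (simp add: norm_mult)
      then show ?thesis
        using \<open>M > 0\<close> by (simp add: \<delta>_def)
    qed
    ultimately show "norm (g t z - R t z) \<le> \<epsilon>"
      using n[OF t z] unfolding R by norm
  qed
qed

theorem theorem3p2:
  fixes \<Omega> S \<O> :: "complex set"
    and \<gamma>\<^sub>0 \<gamma>\<^sub>1 \<gamma>' :: "real \<Rightarrow> complex"
    and X :: "real \<Rightarrow> complex \<Rightarrow> complex"
    and F :: "real \<Rightarrow> real \<Rightarrow> complex \<Rightarrow> complex"
    and \<Phi> :: "real \<Rightarrow> complex \<Rightarrow> real"
    and f :: "real \<Rightarrow> complex \<Rightarrow> complex"
    and p :: nat and \<epsilon> :: real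
  assumes "smooth_bounded_domain \<Omega>"
    and "S \<subseteq> - \<Omega>" and "\<forall>C\<in>components (- \<Omega>). \<exists>!s. s \<in> S \<inter> C"
    and "smooth_jordan_curve \<gamma>\<^sub>0" and "smooth_jordan_curve \<gamma>\<^sub>1"
    and "homotopic_loops \<Omega> \<gamma>\<^sub>0 \<gamma>\<^sub>1"
    and "real_analytic_on UNIV \<gamma>\<^sub>0"
    and "smooth_on ({0..1} \<times> \<Omega>) (\<lambda>(t, x). X t x)"
    and "\<forall>x\<in>\<Omega>. X 0 x = 0 \<and> X 1 x = 0"
    and "\<forall>t\<in>{0..1}. \<forall>x\<in>frontier \<Omega>. X t x = 0"
    and "\<forall>t\<in>{0..1}. \<forall>x\<in>\<Omega>. divergence (X t) x = 0"
    and "is_flow \<Omega> X F"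
    and "\<forall>t\<in>{0..1}. F 0 t ` path_image \<gamma>\<^sub>0 \<subseteq> \<Omega>"
    and "F 0 1 ` path_image \<gamma>\<^sub>0 = path_image \<gamma>\<^sub>1"
    and "open \<O>" and "\<O> \<subseteq> \<Omega>" and "closure \<O> \<subseteq> \<Omega>"
    and "card (components (- \<O>)) = p + 1"
    and "\<forall>C\<in>components (- \<O>). \<exists>!s. s \<in> S \<inter> C"
    and "\<forall>t\<in>{0..1}. F 0 t ` path_image \<gamma>\<^sub>0 \<subseteq> \<O>"
    and "smooth_time_cpt_on \<Omega> X" and "smooth_time_analytic_cpt_on \<O> X"
    and "smooth_time_analytic_cpt_on \<O> \<Phi>"
    and "\<forall>t\<in>{0..1}. \<forall>x\<in>\<O>. GDERIV (\<Phi> t) x :> X t x"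
    and "jordan_curve \<gamma>'"
    and "path_image \<gamma>\<^sub>0 \<subseteq> inside (path_image \<gamma>')" and "inside (path_image \<gamma>') \<subseteq> \<O>"
    and "\<forall>t\<in>{0..1}. \<forall>x\<in>\<O>. GDERIV (\<Phi> t) x :> vfield (f t) x"
    and "\<epsilon> > 0"
  shows "\<exists>R :: real \<Rightarrow> complex \<Rightarrow> complex.
    smooth_time_analytic_on (- S) R \<and>
    (\<forall>t\<in>{0..1}. rational_with_poles_exactly S (R t)) \<and>
    (SUP t\<in>{0..1}. esssup (lebesgue_on (inside (F 0 t ` path_image \<gamma>\<^sub>0)))
        (\<lambda>z. ereal (norm (f t z - R t z)))) \<le> ereal \<epsilon>"
proof -
  have "open \<Omega>" and "bounded \<Omega>"
    using assms(1) by (auto simp: smooth_bounded_domain_def)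
  have "open \<O>" and "\<O> \<subseteq> \<Omega>"
    using assms(15,16) .
  have "bounded \<O>"
    using \<open>bounded \<Omega>\<close> \<open>\<O> \<subseteq> \<Omega>\<close> bounded_subset by blast
  have SO: "S \<inter> \<O> = {}"
    using assms(2) \<open>\<O> \<subseteq> \<Omega>\<close> by blast
  \<comment> \<open>A set of nonzero cardinality is finite, and distinct points of \<open>S\<close>
    lie in distinct components of \<open>- \<O>\<close>.\<close>
  have "finite S"
  proof (rule inj_on_finite)
    show "finite (components (- \<O>))"
      using assms(18) by (metis add_is_0 card.infinite one_neq_zero)
    have comp: "connected_component_set (- \<O>) s \<in> components (- \<O>)"
      "s \<in> connected_component_set (- \<O>) s" if "s \<in> S" for s
      using that SO by (auto simp: components_def)
    then show "connected_component_set (- \<O>) ` S \<subseteq> components (- \<O>)"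
      by auto
    show "inj_on (connected_component_set (- \<O>)) S"
      using assms(19) comp by (intro inj_onI) (metis IntI)
  qed
  obtain L where "L \<ge> 0" and L: "\<And>t x y. t \<in> {0..1} \<Longrightarrow> x \<in> \<Omega> \<Longrightarrow> y \<in> \<Omega> \<Longrightarrow>
      norm (X t x - X t y) \<le> L * norm (x - y)"
    using smooth_time_cpt_on_lipschitz[OF \<open>open \<Omega>\<close> assms(21)] by blast
  have \<gamma>0: "jordan_curve \<gamma>\<^sub>0" "path \<gamma>\<^sub>0" "pathfinish \<gamma>\<^sub>0 = pathstart \<gamma>\<^sub>0"
    using assms(4) by (auto simp: smooth_jordan_curve_def jordan_curve_def simple_path_imp_path)
  have \<gamma>0_sub: "path_image \<gamma>\<^sub>0 \<subseteq> \<Omega>"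
    using assms(26,27) \<open>\<O> \<subseteq> \<Omega>\<close> by blast
  \<comment> \<open>The inside of \<gamma>' is simply connected, contains the initial curve and does
    not contain \<open>z\<close>.\<close>
  have wind: "winding_number \<gamma>\<^sub>0 z = 0" if "z \<notin> \<O>" for z
  proof (rule simply_connected_imp_winding_number_zero)
    show "simply_connected (inside (path_image \<gamma>'))"
      using assms(25) by (simp add: jordan_curve_def simply_connected_inside_simple_path)
  qed (use \<gamma>0 assms(26,27) that in auto)
  have inside: "inside (F 0 t ` path_image \<gamma>\<^sub>0) \<subseteq> \<O>" if "t \<in> {0..1}" for t
    using inside_flow_image_subset[OF assms(12) \<open>L \<ge> 0\<close> L \<gamma>0(1) \<gamma>0_sub _ wind that] assms(20)
    by blast
  \<comment> \<open>The region swept by the curve is compact, which provides one distance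
    \<open>r\<close> for all times.\<close>
  define \<Gamma> where "\<Gamma> = (\<lambda>(t, x). F 0 t x) ` ({0..1} \<times> path_image \<gamma>\<^sub>0)"
  have "continuous_on ({0..1} \<times> path_image \<gamma>\<^sub>0) (\<lambda>(t, x). F 0 t x)"
    using is_flow_continuous_on[OF assms(12) \<open>L \<ge> 0\<close> L] \<gamma>0_sub by (auto elim: continuous_on_subset)
  then have "compact \<Gamma>"
    unfolding \<Gamma>_def using \<gamma>0(2) by (intro compact_continuous_image compact_Times compact_path_image) auto
  moreover have "\<Gamma> \<subseteq> \<O>"
    unfolding \<Gamma>_def using assms(20) by auto
  ultimately obtain r where "r > 0" and r: "(\<Union>x\<in>\<Gamma>. cball x r) \<subseteq> \<O>"
    using compact_subset_open_imp_cball_epsilon_subset[OF _ \<open>open \<O>\<close>] by metis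
  define K where "K = {w. \<forall>z\<in>- \<O>. r \<le> dist z w}"
  have "compact K" and "K \<subseteq> \<O>"
    using compact_points_away_from_complement[OF \<open>open \<O>\<close> \<open>bounded \<O>\<close> \<open>r > 0\<close>] by (auto simp: K_def)
  have inside_K: "inside (F 0 t ` path_image \<gamma>\<^sub>0) \<subseteq> K" if "t \<in> {0..1}" for t
    unfolding K_def
  proof (rule inside_subset_points_away_from_complement[OF inside[OF that]])
    have "F 0 t ` path_image \<gamma>\<^sub>0 \<subseteq> \<Gamma>"
      unfolding \<Gamma>_def using that by auto
    with r show "(\<Union>x\<in>F 0 t ` path_image \<gamma>\<^sub>0. cball x r) \<subseteq> \<O>"
      by blast
  qed
  have poles: "\<exists>s\<in>S. connected_component (- K) w s" if "w \<notin> K" for w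
    using that unfolding K_def
  proof (rule connected_component_away_from_complement[OF _ \<open>r > 0\<close>, rotated])
    show "S \<inter> C \<noteq> {}" if "C \<in> components (- \<O>)" for C
      using assms(19) that by blast
  qed
  \<comment> \<open>Both gradients of \<open>\<Phi> t\<close> coincide on \<open>\<O>\<close>, so
    \<open>f\<close> inherits there the regularity of \<open>X\<close> in space and time.\<close>
  have f_eq: "f t z = cnj (X t z)" if "t \<in> {0..1}" "z \<in> \<O>" for t z
  proof -
    have "GDERIV (\<Phi> t) z :> X t z" "GDERIV (\<Phi> t) z :> vfield (f t) z"
      using assms(24,28) that by auto
    then have "(\<lambda>h. h \<bullet> X t z) = (\<lambda>h. h \<bullet> vfield (f t) z)"
      unfolding gderiv_def by (rule has_derivative_unique)
    then have "X t z = vfield (f t) z"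
      by (metis vector_eq_ldot)
    then show ?thesis
      by (simp add: vfield_def complex_eq_iff)
  qed
  obtain X' where X': "\<And>p. p \<in> {0..1} \<times> \<Omega> \<Longrightarrow>
      ((\<lambda>(t, x). X t x) has_derivative X' p) (at p within {0..1} \<times> \<Omega>)"
    using smooth_on_derivative[OF assms(8)] by blast
  have hol: "f t holomorphic_on \<O>" if t: "t \<in> {0..1}" for t
  proof -
    have "X t differentiable at z" if "z \<in> \<O>" for z
      using has_derivative_time_slice[OF X' \<open>open \<Omega>\<close> t] that \<open>\<O> \<subseteq> \<Omega>\<close>
      unfolding differentiable_def by blast
    then have "(\<lambda>z. cnj (X t z)) holomorphic_on \<O>"
      using assms(11,24) t \<open>\<O> \<subseteq> \<Omega>\<close>
      by (intro holomorphic_on_cnj_gradient[OF \<open>open \<O>\<close>, of "\<Phi> t"]) auto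
    then show ?thesis
      by (rule holomorphic_transform) (simp add: f_eq[OF t])
  qed
  have cont: "continuous_on ({0..1} \<times> K) (\<lambda>(t, z). f t z)"
  proof -
    have "continuous_on ({0..1} \<times> K) (\<lambda>p. cnj ((\<lambda>(t, z). X t z) p))"
      using smooth_on_imp_continuous_on[OF assms(8)] \<open>K \<subseteq> \<O>\<close> \<open>\<O> \<subseteq> \<Omega>\<close>
      by (intro continuous_on_cnj) (auto elim!: continuous_on_subset)
    then show ?thesis
      by (rule continuous_on_eq) (use f_eq \<open>K \<subseteq> \<O>\<close> in auto)
  qed
  obtain R where R: "smooth_time_analytic_on (- S) R" "\<And>t. rational_with_poles_exactly S (R t)"
    and R_hol: "\<And>t. R t holomorphic_on - S"
    and approx: "\<And>t z. t \<in> {0..1} \<Longrightarrow> z \<in> K \<Longrightarrow> norm (f t z - R t z) \<le> \<epsilon>"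
    using rational_approximation_in_time[OF \<open>compact K\<close> \<open>open \<O>\<close> \<open>K \<subseteq> \<O>\<close> \<open>finite S\<close> SO poles hol cont
        \<open>\<epsilon> > 0\<close>] by blast
  \<comment> \<open>Besides the pointwise bound on \<open>K\<close>, \<open>esssup_I\<close> asks
    for measurability, which follows from continuity on the open inside.\<close>
  have "esssup (lebesgue_on (inside (F 0 t ` path_image \<gamma>\<^sub>0))) (\<lambda>z. ereal (norm (f t z - R t z))) \<le> ereal \<epsilon>"
    if t: "t \<in> {0..1}" for t
  proof (rule esssup_I)
    let ?V = "inside (F 0 t ` path_image \<gamma>\<^sub>0)"
    have "continuous_on (path_image \<gamma>\<^sub>0) (F 0 t)"
    proof -
      have "continuous_on (path_image \<gamma>\<^sub>0) (\<lambda>x. (\<lambda>(t, x). F 0 t x) (t, x))"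
        by (rule continuous_on_compose2[OF is_flow_continuous_on[OF assms(12) \<open>L \<ge> 0\<close> L]])
          (use t \<gamma>0_sub in \<open>auto intro!: continuous_intros\<close>)
      then show ?thesis
        by simp
    qed
    then have "open ?V"
      using \<gamma>0(2) by (intro open_inside compact_imp_closed compact_continuous_image compact_path_image)
    have "continuous_on ?V (\<lambda>z. norm (f t z - R t z))"
      using hol[OF t] R_hol[of t] inside[OF t] SO
      by (intro continuous_intros holomorphic_on_imp_continuous_on)
        (auto elim!: holomorphic_on_subset)
    then have "(\<lambda>z. norm (f t z - R t z)) \<in> borel_measurable (lebesgue_on ?V)"
      using \<open>open ?V\<close> by (intro continuous_imp_measurable_on_sets_lebesgue) auto
    then show "(\<lambda>z. ereal (norm (f t z - R t z))) \<in> borel_measurable (lebesgue_on ?V)"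
      by (rule borel_measurable_ereal)
    show "AE z in lebesgue_on ?V. ereal (norm (f t z - R t z)) \<le> ereal \<epsilon>"
      using approx[OF t] inside_K[OF t] by (intro AE_I2) auto
  qed
  then have "(SUP t\<in>{0..1}. esssup (lebesgue_on (inside (F 0 t ` path_image \<gamma>\<^sub>0)))
      (\<lambda>z. ereal (norm (f t z - R t z)))) \<le> ereal \<epsilon>"
    by (rule SUP_least)
  with R show ?thesis
    by blast
qed

end
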